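(* The class of $\overline{K_{1,3}+2P_1}$-free chordal graphs has bounded clique-width.
   Context: All graphs are finite, simple and undirected. $G$ is $H$-free if it has no induced subgraph isomorphic to $H$. A graph is chordal if it contains no induced cycle $C_r$ with $r\geq 4$. $K_{1,3}$ is the claw, $P_1$ the one-vertex graph, $+$ denotes disjoint union, $2P_1$ two isolated vertices, and $\overline{G}$ the complement of $G$. The clique-width of a graph $G$ is the minimum number $k$ of labels needed to construct $G$ using the operations: create a single vertex with label $i$; take the disjoint union of two labelled graphs; add all edges between vertices of label $i$ and vertices of label $j$ ($i\neq j$); rename label $i$ to $j$. A class of graphs has bounded clique-width if there is a constant $c$ such that every graph in the class has clique-width at most $c$. *)

theory Defs
  imports "Graph_Theory.Graph_Theory"
begin

text \<open>
  Finite simple undirected graphs are the symmetric loop-free finite digraphs of locale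
  \<^locale>\<open>pair_graph\<close>: an edge between u and v is the pair of arcs (u, v), (v, u).
\<close>

section \<open>Basic graphs and operations\<close>

definition complement :: "'a pair_pre_digraph \<Rightarrow> 'a pair_pre_digraph" where
  "complement G = \<lparr> pverts = pverts G,
     parcs = {(u, v). u \<in> pverts G \<and> v \<in> pverts G \<and> u \<noteq> v \<and> (u, v) \<notin> parcs G} \<rparr>"

definition graph_sum :: "'a pair_pre_digraph \<Rightarrow> 'b pair_pre_digraph \<Rightarrow> ('a + 'b) pair_pre_digraph"
    (infixl \<open>\<oplus>\<^sub>G\<close> 65) where
  "G \<oplus>\<^sub>G H = \<lparr> pverts = pverts G <+> pverts H,
     parcs = map_prod Inl Inl ` parcs G \<union> map_prod Inr Inr ` parcs H \<rparr>"

definition claw :: "nat pair_pre_digraph" where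
  "claw = \<lparr> pverts = {0, 1, 2, 3}, parcs = {0} \<times> {1, 2, 3} \<union> {1, 2, 3} \<times> {0} \<rparr>"

definition P1 :: "nat pair_pre_digraph" where
  "P1 = \<lparr> pverts = {0}, parcs = {} \<rparr>"

text \<open>Only meaningful for \<open>r \<ge> 3\<close>.\<close>

definition cycle_graph :: "nat \<Rightarrow> nat pair_pre_digraph" where
  "cycle_graph r = \<lparr> pverts = {0..<r},
     parcs = {(i, j). i < r \<and> j < r \<and> (j = Suc i mod r \<or> i = Suc j mod r)} \<rparr>"

section \<open>Induced subgraphs and chordality\<close>

definition free_of :: "'b pair_pre_digraph \<Rightarrow> 'a pair_pre_digraph \<Rightarrow> bool" where
  "free_of H G \<longleftrightarrow>
     \<not> (\<exists>S :: 'a pair_pre_digraph.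
          induced_subgraph (with_proj S) (with_proj G) \<and> digraph_iso (with_proj H) (with_proj S))"

definition chordal :: "'a pair_pre_digraph \<Rightarrow> bool" where
  "chordal G \<longleftrightarrow> (\<forall>r\<ge>4. free_of (cycle_graph r) G)"

section \<open>Clique-width\<close>

text \<open>
  \<open>cw_labelled k G l\<close>: the graph \<open>G\<close>, with the vertex \<open>v\<close> carrying the label \<open>l v\<close>, is built by
  the four clique-width operations with labels in \<open>{1..k}\<close>. Values of \<open>l\<close> outside
  \<open>pverts G\<close> are irrelevant.
\<close>

inductive cw_labelled :: "nat \<Rightarrow> 'a pair_pre_digraph \<Rightarrow> ('a \<Rightarrow> nat) \<Rightarrow> bool" for k :: nat where
  create: "i \<in> {1..k} \<Longrightarrow> cw_labelled k \<lparr> pverts = {v}, parcs = {} \<rparr> (\<lambda>_. i)"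
| disjoint_union:
    "cw_labelled k G l \<Longrightarrow> cw_labelled k H m \<Longrightarrow> pverts G \<inter> pverts H = {} \<Longrightarrow>
     cw_labelled k \<lparr> pverts = pverts G \<union> pverts H, parcs = parcs G \<union> parcs H \<rparr>
       (\<lambda>v. if v \<in> pverts G then l v else m v)"
| join:
    "cw_labelled k G l \<Longrightarrow> i \<in> {1..k} \<Longrightarrow> j \<in> {1..k} \<Longrightarrow> i \<noteq> j \<Longrightarrow>
     cw_labelled k \<lparr> pverts = pverts G,
       parcs = parcs G \<union> {(u, v). u \<in> pverts G \<and> v \<in> pverts G \<and>
         (l u = i \<and> l v = j \<or> l u = j \<and> l v = i)} \<rparr> l"
| relabel:
    "cw_labelled k G l \<Longrightarrow> i \<in> {1..k} \<Longrightarrow> j \<in> {1..k} \<Longrightarrow>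
     cw_labelled k G (\<lambda>v. if l v = i then j else l v)"

text \<open>
  The four operations never produce the graph without vertices; its clique-width is set to 0.
  For every other finite simple graph the minimum exists, see \<open>clique_width_attained\<close>.
\<close>

definition clique_width :: "'a pair_pre_digraph \<Rightarrow> nat" where
  "clique_width G = (if pverts G = {} then 0 else (LEAST k. \<exists>l. cw_labelled k G l))"

text \<open>
  A class is a set of graphs on one vertex type; with an infinite vertex type such as \<^typ>\<open>nat\<close>
  every finite graph occurs up to isomorphism.
\<close>

definition bounded_clique_width :: "'a pair_pre_digraph set \<Rightarrow> bool" where
  "bounded_clique_width \<C> \<longleftrightarrow> (\<exists>c. \<forall>G\<in>\<C>. clique_width G \<le> c)"

section \<open>Sanity lemmas\<close>

lemma pair_graph_iff:
  "pair_graph G \<longleftrightarrow> finite (pverts G) \<and> parcs G \<subseteq> pverts G \<times> pverts G \<and> sym (parcs G) \<and>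
     (\<forall>v. (v, v) \<notin> parcs G)"
proof
  assume "pair_graph G"
  then interpret pair_graph G .
  show "finite (pverts G) \<and> parcs G \<subseteq> pverts G \<times> pverts G \<and> sym (parcs G) \<and>
     (\<forall>v. (v, v) \<notin> parcs G)"
    using pair_finite_verts pair_no_loops[of "(v, v)" for v]
    by (auto intro: symI arcs_symmetric dest: in_arcsD1 in_arcsD2)
next
  assume *: "finite (pverts G) \<and> parcs G \<subseteq> pverts G \<times> pverts G \<and> sym (parcs G) \<and>
     (\<forall>v. (v, v) \<notin> parcs G)"
  then have "finite (parcs G)" by (meson finite_SigmaI finite_subset)
  with * show "pair_graph G"
    by unfold_locales (auto simp: symmetric_def)
qed

lemma pair_graph_complement: "pair_graph G \<Longrightarrow> pair_graph (complement G)"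
  by (auto simp: pair_graph_iff complement_def sym_def)

lemma pair_graph_sum: "pair_graph G \<Longrightarrow> pair_graph H \<Longrightarrow> pair_graph (G \<oplus>\<^sub>G H)"
  by (auto simp: pair_graph_iff graph_sum_def sym_def)

lemma pair_graph_claw: "pair_graph claw"
  by (auto simp: pair_graph_iff claw_def sym_def)

lemma claw_complete_bipartite: "complete_bipartite_digraph 1 3 (with_proj claw)"
  unfolding complete_bipartite_digraph_pair_def
proof (intro conjI exI)
  show "pverts claw = {0} \<union> {1, 2, 3}" "parcs claw = {0} \<times> {1, 2, 3} \<union> {1, 2, 3} \<times> {0}"
    by (auto simp: claw_def)
qed (simp_all add: claw_def)

lemma pair_graph_P1: "pair_graph P1"
  by (auto simp: pair_graph_iff P1_def sym_def)

lemma pair_graph_cycle_graph: "r \<ge> 3 \<Longrightarrow> pair_graph (cycle_graph r)"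
  by (auto simp: pair_graph_iff cycle_graph_def sym_def mod_Suc split: if_splits)

lemma cw_labelled_pair_graph:
  "cw_labelled k G l \<Longrightarrow> pair_graph G \<and> pverts G \<noteq> {} \<and> l ` pverts G \<subseteq> {1..k}"
proof (induction rule: cw_labelled.induct)
  case (disjoint_union G l H m)
  then show ?case by (auto simp: pair_graph_iff sym_def)
qed (auto simp: pair_graph_iff sym_def)

text \<open>Induced copies as adjacency-preserving and -reflecting embeddings.\<close>

lemma free_of_iff:
  fixes G :: "'a pair_pre_digraph" and H :: "'b pair_pre_digraph"
  assumes G: "pair_graph G" and H: "pair_graph H"
  shows "free_of H G \<longleftrightarrow>
    \<not> (\<exists>f. inj_on f (pverts H) \<and> f ` pverts H \<subseteq> pverts G \<and>
        (\<forall>u\<in>pverts H. \<forall>v\<in>pverts H. (u, v) \<in> parcs H \<longleftrightarrow> (f u, f v) \<in> parcs G))"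
proof -
  interpret G: pair_graph G by fact
  interpret H: pair_graph H by fact
  have "(\<exists>S :: 'a pair_pre_digraph. induced_subgraph (with_proj S) (with_proj G) \<and>
            digraph_iso (with_proj H) (with_proj S)) \<longleftrightarrow>
     (\<exists>f. inj_on f (pverts H) \<and> f ` pverts H \<subseteq> pverts G \<and>
        (\<forall>u\<in>pverts H. \<forall>v\<in>pverts H. (u, v) \<in> parcs H \<longleftrightarrow> (f u, f v) \<in> parcs G))"
    (is "?L \<longleftrightarrow> ?R")
  proof
    assume ?L
    then obtain S h where S: "induced_subgraph (with_proj S) (with_proj G)"
      and h: "pre_digraph.digraph_isomorphism (with_proj H) h"
      and eq: "with_proj S = app_iso h (with_proj H)"
      by (auto simp: digraph_iso_def)
    define f where "f = iso_verts h"
    have t: "iso_tail h = fst" "iso_head h = snd"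
      using arg_cong[OF eq, of tail] arg_cong[OF eq, of head] by auto
    have V: "pverts S = f ` pverts H" and A: "parcs S = iso_arcs h ` parcs H"
      using arg_cong[OF eq, of verts] arg_cong[OF eq, of arcs] by (auto simp: f_def)
    have inj: "inj_on f (pverts H)"
      using h by (auto simp: pre_digraph.digraph_isomorphism_def f_def)
    have arc: "iso_arcs h (u, v) = (f u, f v)" if "(u, v) \<in> parcs H" for u v
      using h that by (auto simp: pre_digraph.digraph_isomorphism_def f_def t prod_eq_iff)
    have sub: "pverts S \<subseteq> pverts G"
      and ind: "parcs S = {e \<in> parcs G. fst e \<in> pverts S \<and> snd e \<in> pverts S}"
      using S by (auto simp: induced_subgraph_def subgraph_def)
    have "(u, v) \<in> parcs H \<longleftrightarrow> (f u, f v) \<in> parcs G"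
      if uv: "u \<in> pverts H" "v \<in> pverts H" for u v
    proof
      assume "(u, v) \<in> parcs H"
      then have "(f u, f v) \<in> parcs S" using arc A by force
      then show "(f u, f v) \<in> parcs G" using ind by auto
    next
      assume "(f u, f v) \<in> parcs G"
      then have "(f u, f v) \<in> parcs S" using ind V uv by auto
      then obtain x y where xy: "(x, y) \<in> parcs H" "(f u, f v) = iso_arcs h (x, y)"
        using A by auto
      then have "f x = f u" "f y = f v" using arc by auto
      then have "x = u" "y = v" using inj uv xy(1) H.in_arcsD1 H.in_arcsD2
        by (auto dest: inj_onD)
      then show "(u, v) \<in> parcs H" using xy by simp
    qed
    then show ?R using inj sub V by blast
  next
    assume ?R
    then obtain f where f: "inj_on f (pverts H)" "f ` pverts H \<subseteq> pverts G"
      and e: "\<And>u v. u \<in> pverts H \<Longrightarrow> v \<in> pverts H \<Longrightarrow> (u, v) \<in> parcs H \<longleftrightarrow> (f u, f v) \<in> parcs G"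
      by blast
    define S where "S = \<lparr> pverts = f ` pverts H, parcs = map_prod f f ` parcs H \<rparr>"
    define h where "h = \<lparr> iso_verts = f, iso_arcs = map_prod f f, iso_head = snd, iso_tail = fst \<rparr>"
    have arcsS: "parcs S = {a \<in> parcs G. fst a \<in> pverts S \<and> snd a \<in> pverts S}"
    proof (intro set_eqI iffI)
      fix a assume "a \<in> parcs S"
      then obtain u v where uv: "(u, v) \<in> parcs H" "a = (f u, f v)" by (auto simp: S_def)
      then have "u \<in> pverts H" "v \<in> pverts H" using H.in_arcsD1 H.in_arcsD2 by blast+
      then show "a \<in> {a \<in> parcs G. fst a \<in> pverts S \<and> snd a \<in> pverts S}"
        using uv e by (simp add: S_def)
    next
      fix a assume a: "a \<in> {a \<in> parcs G. fst a \<in> pverts S \<and> snd a \<in> pverts S}"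
      then obtain u v where uv: "u \<in> pverts H" "v \<in> pverts H" "a = (f u, f v)"
        by (cases a) (auto simp: S_def)
      then have "(u, v) \<in> parcs H" using a e by simp
      then show "a \<in> parcs S" using uv(3) by (force simp: S_def)
    qed
    have wfS: "wf_digraph (with_proj S)"
      by unfold_locales (auto simp: S_def dest: H.in_arcsD1 H.in_arcsD2)
    have "induced_subgraph (with_proj S) (with_proj G)"
      using arcsS f(2) wfS G.wf_digraph
      by (auto simp: induced_subgraph_def subgraph_def compatible_def S_def)
    moreover have "inj_on (map_prod f f) (parcs H)"
      using f(1) H.in_arcsD1 H.in_arcsD2 by (auto simp: inj_on_def)
    then have "pre_digraph.digraph_isomorphism (with_proj H) h"
      using f(1) H.wf_digraph by (auto simp: pre_digraph.digraph_isomorphism_def h_def)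
    moreover have "with_proj S = app_iso h (with_proj H)"
      by (simp add: with_proj_def app_iso_def S_def h_def)
    ultimately show ?L unfolding digraph_iso_def by blast
  qed
  then show ?thesis by (simp add: free_of_def)
qed

text \<open>Every nonempty finite simple graph can be built, giving each vertex its own label.\<close>

lemma cw_labelled_edgeless:
  assumes "finite V" "V \<noteq> {}" "l ` V \<subseteq> {1..k}"
  shows "\<exists>m. cw_labelled k \<lparr> pverts = V, parcs = {} \<rparr> m \<and> (\<forall>v\<in>V. m v = l v)"
  using assms
proof (induction V rule: finite_ne_induct)
  case (singleton x)
  then show ?case using cw_labelled.create[of "l x" k x] by auto
next
  case (insert x V)
  then obtain m where m: "cw_labelled k \<lparr> pverts = V, parcs = {} \<rparr> m" "\<forall>v\<in>V. m v = l v"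
    by auto
  have "cw_labelled k \<lparr> pverts = {x}, parcs = {} \<rparr> (\<lambda>_. l x)"
    using insert.prems by (intro cw_labelled.create) auto
  from cw_labelled.disjoint_union[OF this m(1)] insert.hyps m(2) show ?case
    by (intro exI[of _ "\<lambda>v. if v \<in> {x} then l x else m v"]) auto
qed

lemma cw_labelled_exists:
  assumes G: "pair_graph G" and ne: "pverts G \<noteq> {}"
  shows "\<exists>l. cw_labelled (card (pverts G)) G l"
proof -
  let ?V = "pverts G" and ?k = "card (pverts G)"
  have fin: "finite ?V" "finite (parcs G)" and sub: "parcs G \<subseteq> ?V \<times> ?V"
    and "sym (parcs G)" and irr: "\<forall>v. (v, v) \<notin> parcs G"
    using G unfolding pair_graph_iff by (auto intro: finite_subset[OF _ finite_SigmaI])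
  obtain b where b: "bij_betw b ?V {1..?k}"
    using fin(1) by (metis finite_same_card_bij card_atLeastAtMost diff_Suc_1 finite_atLeastAtMost)
  then obtain l where l: "cw_labelled ?k \<lparr> pverts = ?V, parcs = {} \<rparr> l" "\<forall>v\<in>?V. l v = b v"
    using cw_labelled_edgeless[OF fin(1) ne, of b ?k] by (auto simp: bij_betw_def)
  have inj: "inj_on l ?V" and lab: "l v \<in> {1..?k}" if "v \<in> ?V" for v
    using b l(2) that by (auto simp: bij_betw_def inj_on_def)
  have "cw_labelled ?k \<lparr> pverts = ?V, parcs = F \<union> F\<inverse> \<rparr> l" if "F \<subseteq> parcs G" for F
    using finite_subset[OF that fin(2)] that
  proof (induction F rule: finite_induct)
    case empty
    then show ?case using l(1) by simp
  next
    case (insert a F)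
    obtain u v where a: "a = (u, v)" by force
    have uv: "u \<in> ?V" "v \<in> ?V" "u \<noteq> v" using insert.prems sub irr a by auto
    have eq: "l x = l u \<longleftrightarrow> x = u" "l x = l v \<longleftrightarrow> x = v" if "x \<in> ?V" for x
      using inj[OF uv(1)] that uv by (auto dest: inj_onD)
    have new: "{(x, y). x \<in> ?V \<and> y \<in> ?V \<and> (l x = l u \<and> l y = l v \<or> l x = l v \<and> l y = l u)} =
        {(u, v), (v, u)}"
      using uv eq by auto
    have "cw_labelled ?k \<lparr> pverts = ?V, parcs = F \<union> F\<inverse> \<rparr> l" using insert by auto
    from cw_labelled.join[OF this lab[OF uv(1)] lab[OF uv(2)]] eq(2)[OF uv(1)] uv(3)
    have "cw_labelled ?k \<lparr> pverts = ?V, parcs = F \<union> F\<inverse> \<union> {(u, v), (v, u)} \<rparr> l"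
      by (simp add: new)
    moreover have "F \<union> F\<inverse> \<union> {(u, v), (v, u)} = insert a F \<union> (insert a F)\<inverse>"
      using a by auto
    ultimately show ?case by simp
  qed
  from this[of "parcs G"] \<open>sym (parcs G)\<close> have "cw_labelled ?k \<lparr> pverts = ?V, parcs = parcs G \<rparr> l"
    by (simp add: sym_conv_converse_eq)
  then show ?thesis by (cases G) auto
qed

lemma clique_width_attained:
  assumes "pair_graph G" "pverts G \<noteq> {}"
  shows "\<exists>l. cw_labelled (clique_width G) G l"
proof -
  from cw_labelled_exists[OF assms] have "\<exists>k l. cw_labelled k G l" by blast
  from LeastI_ex[OF this] show ?thesis using assms(2) by (simp add: clique_width_def)
qed

end

theory Submission
  imports Defs
begin

text \<open>
  The forbidden graph is a \<open>K\<^sub>5\<close> together with a vertex that sees exactly two of its vertices, so a vertex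
  outside a clique \<open>K\<close> that sees at least two vertices of \<open>K\<close> misses at most two of them.
  Chordality is used in the form: if \<open>Y\<close> is connected and \<open>u \<notin> Y\<close>, then the neighbours of \<open>u\<close>
  in \<open>Y\<close> induce a connected graph. Clique-width is bounded by splitting the vertex set
  recursively into pieces whose vertices have boundedly many different neighbourhoods outside the
  piece; such splittings are combined along the cut vertices, which leaves the 2-connected case.
  If all cliques are small, every piece can be attached to the rest along a clique. Otherwise
  every vertex misses at most two vertices of a maximum clique \<open>K0\<close>, and two such missed
  sets can rarely be disjoint. After deleting at most three vertices, every vertex misses at most one vertex
  of \<open>K0\<close> and adjacent vertices outside \<open>K0\<close> miss the same one, so that the vertices of \<open>K0\<close> can be
  added one at a time, each together with the vertices missing it.
\<close>

section \<open>Splittings with few neighbourhood types\<close>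

lemma card_le_1_singleton: "finite A \<Longrightarrow> card A \<le> 1 \<Longrightarrow> x \<in> A \<Longrightarrow> A = {x}"
  by (metis card_1_singletonE card_eq_0_iff empty_iff le_neq_implies_less less_one singletonD)

lemma card_image_Un_Pow:
  assumes "finite A" "finite S"
  shows "card ((\<lambda>(B, T). B \<union> T) ` (A \<times> Pow S)) \<le> card A * 2 ^ card S"
proof -
  have "card ((\<lambda>(B, T). B \<union> T) ` (A \<times> Pow S)) \<le> card (A \<times> Pow S)"
    using assms by (intro card_image_le) auto
  then show ?thesis using assms by (simp add: card_cartesian_product card_Pow)
qed

locale adjacency =
  fixes adj :: "'a \<Rightarrow> 'a \<Rightarrow> bool"
  assumes adj_sym: "adj u v \<Longrightarrow> adj v u"
    and adj_irrefl: "\<not> adj v v"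
begin

definition nbs :: "'a \<Rightarrow> 'a set" where
  "nbs u = {v. adj u v}"

definition clique :: "'a set \<Rightarrow> bool" where
  "clique K \<longleftrightarrow> (\<forall>x\<in>K. \<forall>y\<in>K. x \<noteq> y \<longrightarrow> adj x y)"

text \<open>Stated through cuts instead of paths. The empty set counts as connected, so a vertex
  without neighbours in \<open>Y\<close> is no exception to the chordality property below.\<close>

definition conn :: "'a set \<Rightarrow> bool" where
  "conn Y \<longleftrightarrow> (\<forall>A\<subseteq>Y. A \<noteq> {} \<longrightarrow> A \<noteq> Y \<longrightarrow> (\<exists>a\<in>A. \<exists>b\<in>Y - A. adj a b))"

text \<open>The distinct rows of the adjacency matrix between \<open>X\<close> and
  \<open>U - X\<close>.\<close>

definition types :: "'a set \<Rightarrow> 'a set \<Rightarrow> 'a set set" where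
  "types U X = (\<lambda>v. nbs v \<inter> (U - X)) ` X"

text \<open>A binary splitting tree of \<open>X\<close> with at most \<open>k\<close> types at every
  node; for \<open>X = U\<close> it says that the module-width is at most \<open>k\<close>. The
  universe is kept apart from \<open>X\<close> so that a piece of a graph can be split with its
  outside neighbours still counted.\<close>

inductive dec :: "nat \<Rightarrow> 'a set \<Rightarrow> 'a set \<Rightarrow> bool" for k U where
  dec_empty: "dec k U {}"
| dec_single: "k > 0 \<Longrightarrow> dec k U {v}"
| dec_Un: "dec k U X \<Longrightarrow> dec k U Y \<Longrightarrow> X \<inter> Y = {} \<Longrightarrow> card (types U (X \<union> Y)) \<le> k \<Longrightarrow>
    dec k U (X \<union> Y)"

lemma in_nbs [simp]: "v \<in> nbs u \<longleftrightarrow> adj u v"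
  by (simp add: nbs_def)

lemma cliqueD: "clique K \<Longrightarrow> x \<in> K \<Longrightarrow> y \<in> K \<Longrightarrow> x \<noteq> y \<Longrightarrow> adj x y"
  by (simp add: clique_def)

section \<open>Connected sets and components\<close>

lemma connI: "(\<And>A. A \<subseteq> Y \<Longrightarrow> A \<noteq> {} \<Longrightarrow> A \<noteq> Y \<Longrightarrow> \<exists>a\<in>A. \<exists>b\<in>Y - A. adj a b) \<Longrightarrow> conn Y"
  by (auto simp: conn_def)

lemma conn_edge:
  assumes "conn Y" "a \<in> Y" "P a" "b \<in> Y" "\<not> P b"
  obtains x y where "x \<in> Y" "y \<in> Y" "P x" "\<not> P y" "adj x y"
proof -
  have "{x \<in> Y. P x} \<subseteq> Y" "{x \<in> Y. P x} \<noteq> {}" "{x \<in> Y. P x} \<noteq> Y"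
    using assms by auto
  then have "\<exists>x\<in>{x \<in> Y. P x}. \<exists>y\<in>Y - {x \<in> Y. P x}. adj x y"
    using assms(1) unfolding conn_def by blast
  then show ?thesis using that by blast
qed

lemma not_connE:
  assumes "\<not> conn Y"
  obtains A where "A \<subseteq> Y" "A \<noteq> {}" "A \<noteq> Y" "\<And>a b. a \<in> A \<Longrightarrow> b \<in> Y - A \<Longrightarrow> \<not> adj a b"
  using assms unfolding conn_def by blast

lemma conn_singleton: "conn {v}"
  by (rule connI) auto

lemma conn_Un:
  assumes "conn A" "conn B" and ab: "a \<in> A" "b \<in> B" "adj a b"
  shows "conn (A \<union> B)"
proof (rule connI)
  fix C assume C: "C \<subseteq> A \<union> B" "C \<noteq> {}" "C \<noteq> A \<union> B"
  show "\<exists>x\<in>C. \<exists>y\<in>(A \<union> B) - C. adj x y"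
  proof (rule ccontr)
    assume no: "\<not> ?thesis"
    have A: "A \<subseteq> C \<or> A \<inter> C = {}"
    proof (rule ccontr)
      assume "\<not> ?thesis"
      then obtain x y where "x \<in> A" "x \<in> C" "y \<in> A" "y \<notin> C" by blast
      from conn_edge[of A x "\<lambda>x. x \<in> C" y, OF assms(1) this] no show False by blast
    qed
    have B: "B \<subseteq> C \<or> B \<inter> C = {}"
    proof (rule ccontr)
      assume "\<not> ?thesis"
      then obtain x y where "x \<in> B" "x \<in> C" "y \<in> B" "y \<notin> C" by blast
      from conn_edge[of B x "\<lambda>x. x \<in> C" y, OF assms(2) this] no show False by blast
    qed
    from A B C ab no adj_sym[OF ab(3)] show False by blast
  qed
qed

lemma conn_insert: "conn B \<Longrightarrow> b \<in> B \<Longrightarrow> adj d b \<Longrightarrow> conn (insert d B)"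
  using conn_Un[OF conn_singleton, of B d d b] by simp

text \<open>For \<open>x\<close> in \<open>Y\<close> this is the component of \<open>x\<close> in
  \<open>Y\<close>. Only the vertices entered have to lie in \<open>Y\<close>, so \<open>x\<close>
  belongs to it in any case.\<close>

definition comp :: "'a set \<Rightarrow> 'a \<Rightarrow> 'a set" where
  "comp Y x = {y. (\<lambda>u v. v \<in> Y \<and> adj u v)\<^sup>*\<^sup>* x y}"

lemma comp_refl: "x \<in> comp Y x"
  by (simp add: comp_def)

lemma comp_subset: "x \<in> Y \<Longrightarrow> comp Y x \<subseteq> Y"
  by (auto simp: comp_def elim: rtranclp.cases)

lemma comp_closed: "y \<in> comp Y x \<Longrightarrow> adj y z \<Longrightarrow> z \<in> Y \<Longrightarrow> z \<in> comp Y x"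
  unfolding comp_def by (auto intro: rtranclp.rtrancl_into_rtrancl)

lemma conn_comp: "conn (comp Y x)"
proof (rule connI)
  fix A assume A: "A \<subseteq> comp Y x" "A \<noteq> {}" "A \<noteq> comp Y x"
  let ?r = "\<lambda>u v. v \<in> Y \<and> adj u v"
  have *: "?r\<^sup>*\<^sup>* x y \<Longrightarrow> (y \<in> A \<longleftrightarrow> x \<in> A) \<or> (\<exists>a\<in>A. \<exists>b\<in>comp Y x - A. adj a b)" for y
  proof (induction rule: rtranclp_induct)
    case (step y z)
    have "y \<in> comp Y x" "z \<in> comp Y x"
      using step by (auto simp: comp_def intro: rtranclp.rtrancl_into_rtrancl)
    then show ?case using step adj_sym by blast
  qed auto
  obtain a b where "a \<in> A" "a \<in> comp Y x" "b \<in> comp Y x" "b \<notin> A" using A by blast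
  with *[of a] *[of b] show "\<exists>a\<in>A. \<exists>b\<in>comp Y x - A. adj a b"
    by (auto simp: comp_def)
qed

text \<open>If the neighbours of \<open>u\<close> in \<open>Y\<close> split into \<open>P\<close>
  and \<open>Q\<close> without edges between them, a shortest walk in \<open>Y\<close> from
  \<open>P\<close> to \<open>Q\<close> is an induced path whose inner vertices do not see
  \<open>u\<close>; together with \<open>u\<close> it forms a hole.\<close>

lemma conn_nbs_if_no_holes:
  assumes no_hole: "\<And>r f. r \<ge> 4 \<Longrightarrow> inj_on f {..<r} \<Longrightarrow>
      (\<And>i j. i < r \<Longrightarrow> j < r \<Longrightarrow> adj (f i) (f j) \<longleftrightarrow> j = Suc i mod r \<or> i = Suc j mod r) \<Longrightarrow> False"
    and Y: "conn Y" and u: "u \<notin> Y"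
  shows "conn (Y \<inter> nbs u)"
proof (rule ccontr)
  assume "\<not> ?thesis"
  then obtain P where P: "P \<subseteq> Y \<inter> nbs u" "P \<noteq> {}" "P \<noteq> Y \<inter> nbs u"
    and PQ: "\<And>a b. a \<in> P \<Longrightarrow> b \<in> Y \<inter> nbs u - P \<Longrightarrow> \<not> adj a b"
    by (rule not_connE) blast
  define Q where "Q = Y \<inter> nbs u - P"
  define walk where "walk m p \<longleftrightarrow> p 0 \<in> P \<and> (\<forall>i\<le>m. p i \<in> Y) \<and> (\<forall>i<m. adj (p i) (p (Suc i)))"
    for m and p :: "nat \<Rightarrow> 'a"
  obtain x0 where x0: "x0 \<in> P" using P(2) by blast
  obtain q where q: "q \<in> Q" using P(1,3) unfolding Q_def by blast
  have ex: "\<exists>m p. walk m p \<and> p m \<in> Q"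
  proof (rule ccontr)
    assume no: "\<not> ?thesis"
    \<comment> \<open>The vertices that walks from \<open>P\<close> reach; an edge of
      \<open>Y\<close> leaving this set would prolong a walk.\<close>
    let ?R = "\<lambda>y. \<exists>m p. walk m p \<and> p m = y"
    have Rx0: "?R x0" using x0 P by (intro exI[of _ 0] exI[of _ "\<lambda>_. x0"]) (auto simp: walk_def)
    have nRq: "\<not> ?R q" using no q by blast
    have Yx0: "x0 \<in> Y" and Yq: "q \<in> Y" using x0 q P by (auto simp: Q_def)
    obtain x y where "x \<in> Y" "y \<in> Y" "?R x" "\<not> ?R y" "adj x y"
      by (rule conn_edge[of Y x0 ?R q, OF Y Yx0 Rx0 Yq nRq])
    then obtain m p where mp: "walk m p" "p m = x" by blast
    have "walk (Suc m) (p(Suc m := y))"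
      using mp \<open>adj x y\<close> \<open>y \<in> Y\<close> by (auto simp: walk_def le_Suc_eq less_Suc_eq)
    moreover have "(p(Suc m := y)) (Suc m) = y" by simp
    ultimately show False using \<open>\<not> ?R y\<close> by blast
  qed
  define m where "m = (LEAST m. \<exists>p. walk m p \<and> p m \<in> Q)"
  from ex have "\<exists>p. walk m p \<and> p m \<in> Q" unfolding m_def by (rule LeastI_ex)
  then obtain p where p: "walk m p" "p m \<in> Q" by blast
  have min: "m \<le> n" if "walk n p'" "p' n \<in> Q" for n p'
    unfolding m_def using that by (intro Least_le) blast
  have inY: "p i \<in> Y" if "i \<le> m" for i using p that by (auto simp: walk_def)
  have step: "adj (p i) (p (Suc i))" if "i < m" for i using p that by (auto simp: walk_def)
  \<comment> \<open>A later visit to \<open>P\<close> would allow the beginning of the walk to be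
    dropped; likewise the walk may stop at its first visit to \<open>Q\<close>.\<close>
  have notP: "p i \<notin> P" if "0 < i" "i \<le> m" for i
  proof
    assume "p i \<in> P"
    then have "walk (m - i) (\<lambda>k. p (k + i))" using p(1) that by (auto simp: walk_def)
    from min[OF this] that p(2) show False by auto
  qed
  have notQ: "p i \<notin> Q" if "i < m" for i
  proof
    assume "p i \<in> Q"
    moreover have "walk i p" using p(1) that by (auto simp: walk_def)
    ultimately show False using min[of i p] that by auto
  qed
  \<comment> \<open>A repeated vertex lets the closed piece between \<open>i\<close> and
    \<open>j\<close> be cut out.\<close>
  have inj: "p i \<noteq> p j" if "i < j" "j \<le> m" for i j
  proof
    assume eq: "p i = p j"
    let ?p = "\<lambda>k. if k \<le> i then p k else p (k + (j - i))"
    have "walk (m - (j - i)) ?p"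
      unfolding walk_def
    proof (intro conjI allI impI)
      fix k assume k: "k < m - (j - i)"
      consider "k < i" | "k = i" | "k > i" by linarith
      then show "adj (?p k) (?p (Suc k))"
        using k that step[of k] step[of j] step[of "k + (j - i)"] eq by cases auto
    qed (use p(1) that inY in \<open>auto simp: walk_def\<close>)
    moreover have "?p (m - (j - i)) = p m"
      using that eq by (cases "j = m") auto
    ultimately show False using min[of "m - (j - i)" ?p] p(2) that by auto
  qed
  \<comment> \<open>A chord replaces the piece between \<open>i\<close> and \<open>j\<close> by a
    single step.\<close>
  have chord: "\<not> adj (p i) (p j)" if "Suc i < j" "j \<le> m" for i j
  proof
    assume adj: "adj (p i) (p j)"
    let ?p = "\<lambda>k. if k \<le> i then p k else p (k + (j - Suc i))"
    have "walk (m - (j - Suc i)) ?p"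
      unfolding walk_def
    proof (intro conjI allI impI)
      fix k assume k: "k < m - (j - Suc i)"
      consider "k < i" | "k = i" | "k > i" by linarith
      then show "adj (?p k) (?p (Suc k))"
        using k that step[of k] step[of "k + (j - Suc i)"] adj by cases auto
    qed (use p(1) that inY in \<open>auto simp: walk_def\<close>)
    moreover have "?p (m - (j - Suc i)) = p m"
      using that by auto
    ultimately show False using min[of "m - (j - Suc i)" ?p] p(2) that by auto
  qed
  have p0: "p 0 \<in> P" using p by (simp add: walk_def)
  have "m \<noteq> 0" using p0 p(2) by (cases m) (auto simp: Q_def)
  moreover have "m \<noteq> 1" using p0 p(2) PQ[of "p 0" "p 1"] step[of 0] by (auto simp: Q_def)
  ultimately have m: "m \<ge> 2" by linarith
  have path: "adj (p i) (p j) \<longleftrightarrow> j = Suc i \<or> i = Suc j" if "i \<le> m" "j \<le> m" for i j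
  proof -
    consider "Suc i < j" | "j = Suc i" | "i = j" | "i = Suc j" | "Suc j < i" by linarith
    then show ?thesis
      using that chord[of i j] chord[of j i] step[of i] step[of j] adj_irrefl adj_sym
      by cases auto
  qed
  have apex: "adj u (p i) \<longleftrightarrow> i = 0 \<or> i = m" if "i \<le> m" for i
  proof (cases "i = 0 \<or> i = m")
    case True
    then show ?thesis using p0 p(2) P(1) by (auto simp: Q_def)
  next
    case False
    then show ?thesis using that notP[of i] notQ[of i] inY[of i] by (auto simp: Q_def)
  qed
  \<comment> \<open>The path has the \<open>m + 1\<close> vertices \<open>p 0\<close>, ...,
    \<open>p m\<close>, and \<open>u\<close> closes it at position \<open>m + 1\<close>;
    \<open>m \<ge> 2\<close> makes the length at least 4.\<close>
  define f where "f i = (if i \<le> m then p i else u)" for i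
  show False
  proof (rule no_hole[of "m + 2" f])
    show "inj_on f {..<m + 2}"
    proof (rule inj_onI)
      fix i j assume "i \<in> {..<m + 2}" "j \<in> {..<m + 2}" "f i = f j"
      then show "i = j" using inj[of i j] inj[of j i] inY[of i] inY[of j] u
        by (auto simp: f_def split: if_splits) (metis linorder_neqE_nat)
    qed
    fix i j assume ij: "i < m + 2" "j < m + 2"
    have u': "adj (p i) u \<longleftrightarrow> adj u (p i)" for i using adj_sym by blast
    show "adj (f i) (f j) \<longleftrightarrow> j = Suc i mod (m + 2) \<or> i = Suc j mod (m + 2)"
      using ij path[of i j] apex[of i] apex[of j] m adj_irrefl[of u] u'[of i]
      by (auto simp: f_def mod_Suc not_le)
  qed (use m in auto)
qed

section \<open>Changing the universe of a splitting\<close>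

lemma dec_finite: "dec k U X \<Longrightarrow> finite X"
  by (induction rule: dec.induct) auto

lemma dec_mono: "dec k U X \<Longrightarrow> k \<le> k' \<Longrightarrow> dec k' U X"
  by (induction rule: dec.induct) (auto intro: dec.intros)

lemma finite_types: "finite X \<Longrightarrow> finite (types U X)"
  by (simp add: types_def)

lemma card_types_self: "card (types U U) \<le> 1"
proof -
  have "types U U \<subseteq> {{}}" by (auto simp: types_def)
  then show ?thesis using card_mono[of "{{}}" "types U U"] by simp
qed

lemma card_types_le_power:
  assumes "finite S" "\<And>x. x \<in> X \<Longrightarrow> nbs x \<inter> (U - X) \<subseteq> S"
  shows "card (types U X) \<le> 2 ^ card S"
proof -
  have "types U X \<subseteq> Pow S" using assms(2) by (auto simp: types_def)
  then show ?thesis using card_mono[of "Pow S" "types U X"] assms(1) by (simp add: card_Pow)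
qed

text \<open>Adjacency to the new vertex splits each type into at most two.\<close>

lemma dec_insert_universe: "dec k U X \<Longrightarrow> dec (2 * k) (insert x U) X"
proof (induction rule: dec.induct)
  case (dec_Un X Y)
  let ?Z = "X \<union> Y"
  have fin: "finite ?Z" using dec_Un dec_finite by blast
  have "nbs v \<inter> (insert x U - ?Z) = (nbs v \<inter> (U - ?Z)) \<union> (nbs v \<inter> ({x} - ?Z))" for v
    by blast
  then have "types (insert x U) ?Z \<subseteq> (\<lambda>(A, B). A \<union> B) ` (types U ?Z \<times> Pow {x})"
    by (fastforce simp: types_def)
  from card_mono[OF _ this] have "card (types (insert x U) ?Z) \<le> card (types U ?Z) * 2 ^ card {x}"
    using finite_types[OF fin] card_image_Un_Pow[of "types U ?Z" "{x}"]
    by (meson finite.emptyI finite.insertI finite_Pow_iff finite_SigmaI finite_imageI le_trans)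
  then show ?case using dec_Un by (intro dec.dec_Un) auto
qed (auto intro: dec.intros)

text \<open>Each new vertex doubles the number of types and is then joined as a leaf at the root,
  where nothing is left outside and only one type occurs.\<close>

lemma dec_add_vertices:
  assumes "finite Z" "dec k U U" "k > 0"
  shows "dec (2 ^ card Z * k) (U \<union> Z) (U \<union> Z)"
  using assms(1)
proof (induction Z rule: finite_induct)
  case empty
  then show ?case using assms by simp
next
  case (insert z Z)
  let ?W = "U \<union> Z" and ?k = "2 ^ card (insert z Z) * k"
  have k: "?k = 2 * (2 ^ card Z * k)" using insert.hyps by simp
  show ?case
  proof (cases "z \<in> ?W")
    case True
    then have "U \<union> insert z Z = ?W" by auto
    with insert.IH dec_mono k show ?thesis by auto
  next
    case False
    have "dec ?k (insert z ?W) ?W" unfolding k by (rule dec_insert_universe[OF insert.IH])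
    moreover have "dec ?k (insert z ?W) {z}" using assms(3) by (intro dec_single) simp
    moreover have "card (types (insert z ?W) (?W \<union> {z})) \<le> ?k"
      using card_types_self[of "insert z ?W"] assms(3) by (simp add: le_trans Suc_leI)
    ultimately have "dec ?k (insert z ?W) (?W \<union> {z})"
      using False by (intro dec_Un[of _ _ ?W]) auto
    then show ?thesis by simp
  qed
qed

text \<open>When all of \<open>Z\<close> sees the same set \<open>T\<close> in the added part of the
  universe, every old type is just enlarged by \<open>T\<close>, and no type splits.\<close>

lemma dec_transfer:
  assumes "dec k W Z" "W \<subseteq> U" "Z \<subseteq> W" "\<And>v. v \<in> Z \<Longrightarrow> nbs v \<inter> (U - W) = T"
  shows "dec k U Z"
  using assms
proof (induction rule: dec.induct)
  case (dec_Un X Y)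
  let ?Z = "X \<union> Y"
  have "nbs v \<inter> (U - ?Z) = (nbs v \<inter> (W - ?Z)) \<union> T" if "v \<in> ?Z" for v
  proof -
    have "U - ?Z = (W - ?Z) \<union> (U - W)" using dec_Un.prems by blast
    then show ?thesis using dec_Un.prems(3)[OF that] by blast
  qed
  then have "types U ?Z = (\<lambda>A. A \<union> T) ` types W ?Z"
    by (auto simp: types_def image_image)
  then have "card (types U ?Z) \<le> card (types W ?Z)"
    using card_image_le finite_types dec_finite dec_Un.hyps by (metis finite_UnI)
  then show ?case using dec_Un by (intro dec.dec_Un) auto
qed (auto intro: dec.intros)

end

section \<open>Chordal graphs\<close>

locale chordal_adjacency = adjacency +
  assumes conn_nbs: "conn Y \<Longrightarrow> u \<notin> Y \<Longrightarrow> conn (Y \<inter> nbs u)"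
begin

text \<open>Induction on \<open>S\<close>: after passing from \<open>C\<close> to the neighbours of
  \<open>s\<close> in \<open>C\<close>, which stay connected, every other \<open>t\<close> in
  \<open>S\<close> still has a neighbour there.\<close>

lemma complete_vertex:
  assumes "finite S" "clique S" "conn C" "C \<noteq> {}" "S \<inter> C = {}"
    and "\<And>s. s \<in> S \<Longrightarrow> \<exists>c\<in>C. adj s c"
  shows "\<exists>v\<in>C. S \<subseteq> nbs v"
  using assms
proof (induction S arbitrary: C rule: finite_induct)
  case empty
  then show ?case by auto
next
  case (insert s S)
  let ?C = "C \<inter> nbs s"
  have nonempty: "?C \<noteq> {}" using insert.prems(5)[of s] by auto
  have "\<exists>c\<in>?C. adj t c" if t: "t \<in> S" for t
  proof -
    obtain c where c: "c \<in> C" "adj t c" using insert.prems(5)[of t] t by auto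
    have "adj s t" using insert.prems(1) insert.hyps t by (auto simp: clique_def)
    \<comment> \<open>This connected set contains \<open>t\<close>, which sees \<open>s\<close>, and
      a vertex of \<open>C\<close>; hence an edge leaves \<open>t\<close> inside it and ends at a
      common neighbour of \<open>s\<close> and \<open>t\<close> in \<open>C\<close>.\<close>
    have con: "conn (insert t C \<inter> nbs s)"
      using insert.prems(2,4) insert.hyps t c by (intro conn_nbs conn_insert) auto
    obtain d where d: "d \<in> insert t C \<inter> nbs s" "d \<noteq> t"
      using nonempty t insert.prems(4) by blast
    have "t \<in> insert t C \<inter> nbs s" using \<open>adj s t\<close> by simp
    then obtain x y where "y \<in> insert t C \<inter> nbs s" "x = t" "y \<noteq> t" "adj x y"
      by (rule conn_edge[of _ t "\<lambda>x. x = t" d, OF con _ refl d])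
    then show ?thesis by auto
  qed
  moreover have "conn ?C" using insert.prems by (intro conn_nbs) auto
  moreover have "clique S" "S \<inter> ?C = {}" using insert.prems by (auto simp: clique_def)
  ultimately obtain v where "v \<in> ?C" "S \<subseteq> nbs v" using insert.IH[of ?C] nonempty by blast
  then show ?case using adj_sym by auto
qed

text \<open>On the path \<open>b\<close>, \<open>c\<close>, \<open>d\<close> the vertex
  \<open>a\<close> sees only the ends, and these would have to be connected to each other.\<close>

lemma no_C4:
  assumes "adj a b" "adj b c" "adj c d" "adj d a" "\<not> adj a c" "a \<noteq> c" "\<not> adj b d"
  shows "b = d"
proof (rule ccontr)
  assume "b \<noteq> d"
  have "conn {b, c, d}"
    using assms by (intro conn_insert[of "{c, d}" c] conn_insert[of "{d}" d] conn_singleton) auto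
  moreover have "a \<notin> {b, c, d}" using assms adj_irrefl by auto
  ultimately have "conn ({b, c, d} \<inter> nbs a)" by (rule conn_nbs)
  moreover have "{b, c, d} \<inter> nbs a = {b, d}" using assms adj_sym by auto
  ultimately have "conn {b, d}" by simp
  from conn_edge[OF this, of b "\<lambda>x. x = b" d] \<open>b \<noteq> d\<close> obtain x y
    where "x = b" "y \<in> {b, d}" "y \<noteq> b" "adj x y" by auto
  with assms show False by auto
qed

text \<open>
  Removing a vertex of \<open>X\<close> that is complete to the attachment clique \<open>S\<close> leaves a set that is
  attached to the larger clique \<open>S \<union> {v}\<close>, so that types are always subsets of a clique.
\<close>

lemma dec_if_small_cliques:
  assumes fin: "finite U" and small: "\<And>K. K \<subseteq> U \<Longrightarrow> clique K \<Longrightarrow> card K \<le> n"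
  shows "X \<subseteq> U \<Longrightarrow> S \<subseteq> U - X \<Longrightarrow> clique S \<Longrightarrow> (\<And>x. x \<in> X \<Longrightarrow> nbs x \<inter> (U - X) \<subseteq> S) \<Longrightarrow>
    dec (2 ^ n) U X"
proof (induction "card X" arbitrary: X S rule: less_induct)
  case less
  note X = less.prems
  have finX: "finite X" and finS: "finite S"
    using X fin by (auto intro: finite_subset[OF _ fin])
  have "card (types U X) \<le> 2 ^ card S"
    using X finS by (intro card_types_le_power)
  also have "card S \<le> n" using X by (intro small) auto
  then have "(2::nat) ^ card S \<le> 2 ^ n" by simp
  finally have narrow: "card (types U X) \<le> 2 ^ n" .
  consider "X = {}" | "\<not> conn X" | "X \<noteq> {}" "conn X" by blast
  then show ?case
  proof cases
    case 1
    then show ?thesis by (simp add: dec_empty)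
  next
    case 2
    then obtain A where A: "A \<subseteq> X" "A \<noteq> {}" "A \<noteq> X"
      and no: "\<And>a b. a \<in> A \<Longrightarrow> b \<in> X - A \<Longrightarrow> \<not> adj a b"
      by (rule not_connE) blast
    have "dec (2 ^ n) U A"
    proof (rule less.hyps)
      show "card A < card X" using A finX by (intro psubset_card_mono) auto
      show "nbs x \<inter> (U - A) \<subseteq> S" if "x \<in> A" for x
        using that A(1) X(4)[of x] no[of x] by (fastforce simp: nbs_def)
    qed (use A X in auto)
    moreover have "dec (2 ^ n) U (X - A)"
    proof (rule less.hyps)
      show "card (X - A) < card X" using A finX by (intro psubset_card_mono) auto
      show "nbs x \<inter> (U - (X - A)) \<subseteq> S" if "x \<in> X - A" for x
        using that A(1) X(4)[of x] no[of _ x] adj_sym by (fastforce simp: nbs_def)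
    qed (use A X in auto)
    moreover have "A \<union> (X - A) = X" using A by auto
    ultimately show ?thesis using dec_Un[of "2 ^ n" U A "X - A"] narrow by auto
  next
    case 3
    \<comment> \<open>Attachment vertices that see nothing in \<open>X\<close> are dropped, as
      \<open>complete_vertex\<close> requires a neighbour for each.\<close>
    let ?S = "{s \<in> S. \<exists>x\<in>X. adj s x}"
    have "\<exists>v\<in>X. ?S \<subseteq> nbs v"
    proof (rule complete_vertex)
      show "finite ?S" "clique ?S" "?S \<inter> X = {}" using finS X(2,3) by (auto simp: clique_def)
    qed (use 3 in auto)
    then obtain v where v: "v \<in> X" "?S \<subseteq> nbs v" by blast
    have "dec (2 ^ n) U (X - {v})"
    proof (rule less.hyps)
      show "card (X - {v}) < card X" using v finX by (intro psubset_card_mono) auto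
      show "insert v ?S \<subseteq> U - (X - {v})" using v X by auto
      show "clique (insert v ?S)" using v X(3) adj_sym by (auto simp: clique_def)
      show "nbs x \<inter> (U - (X - {v})) \<subseteq> insert v ?S" if "x \<in> X - {v}" for x
      proof
        fix z assume z: "z \<in> nbs x \<inter> (U - (X - {v}))"
        show "z \<in> insert v ?S"
        proof (cases "z \<in> X")
          case False
          then have "z \<in> S" using X(4)[of x] that z by blast
          moreover have "adj z x" using z by (simp add: adj_sym)
          ultimately show ?thesis using that by blast
        qed (use z in blast)
      qed
    qed (use X in auto)
    from dec_Un[OF this dec_single[of "2 ^ n" U v]] v narrow show ?thesis
      by (simp add: insert_absorb)
  qed
qed

end

section \<open>Two-connected graphs with a large clique\<close>

text \<open>For \<open>card K \<ge> 5\<close> the hypothesis says that no vertex sees exactly two vertices of a \<open>K\<^sub>5\<close>.\<close>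

locale thin_chordal = chordal_adjacency +
  assumes few_missed:
    "clique K \<Longrightarrow> finite K \<Longrightarrow> w \<notin> K \<Longrightarrow> 2 \<le> card (K \<inter> nbs w) \<Longrightarrow> card (K - nbs w) \<le> 2"

text \<open>\<open>conn_U\<close> and \<open>conn_del\<close> express 2-connectedness, and
  \<open>K0\<close> is a maximum clique. Size 10 leaves room for a vertex to miss six vertices of
  \<open>K0\<close> and still see two.\<close>

locale big_block = thin_chordal +
  fixes U K0 :: "'a set"
  assumes finite_U: "finite U"
    and conn_U: "conn U"
    and conn_del: "u \<in> U \<Longrightarrow> conn (U - {u})"
    and K0: "K0 \<subseteq> U" "clique K0"
    and K0_max: "K \<subseteq> U \<Longrightarrow> clique K \<Longrightarrow> card K \<le> card K0"
    and K0_big: "card K0 \<ge> 10"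
begin

text \<open>Intended for vertices outside \<open>K0\<close>; a vertex of \<open>K0\<close> would
  count as missing itself.\<close>

definition miss :: "'a \<Rightarrow> 'a set" where
  "miss w = K0 - nbs w"

definition F :: "'a set" where
  "F = U - K0"

lemma finite_K0: "finite K0"
  using K0(1) finite_U by (rule finite_subset)

lemma finite_miss [simp]: "finite (miss w)"
  using finite_K0 by (simp add: miss_def)

text \<open>Propagation from \<open>K0\<close>: let \<open>A\<close> be the vertices satisfying the
  bound. If \<open>A\<close> is not all of \<open>U\<close>, an edge leaves \<open>A\<close> at some
  \<open>u\<close>. By 2-connectedness the neighbours of \<open>u\<close> are connected, so some
  edge among them leads from \<open>a\<close> in \<open>A\<close> to \<open>z'\<close> outside
  \<open>A\<close>. Seeing both \<open>u\<close> and \<open>a\<close> forces \<open>z'\<close> to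
  satisfy the bound too.\<close>

lemma card_miss_U: "w \<in> U \<Longrightarrow> card (K0 - nbs w - {w}) \<le> 2"
proof (rule ccontr)
  assume w: "w \<in> U" "\<not> card (K0 - nbs w - {w}) \<le> 2"
  define A where "A = {w \<in> U. card (K0 - nbs w - {w}) \<le> 2}"
  have "K0 - nbs k - {k} = {}" if k: "k \<in> K0" for k
  proof -
    have "x \<in> insert k (nbs k)" if "x \<in> K0" for x
      using cliqueD[OF K0(2) k that] by (cases "k = x") auto
    then show ?thesis by blast
  qed
  then have "card (K0 - nbs k - {k}) \<le> 2" if "k \<in> K0" for k
    using that by (metis card.empty zero_le)
  then have K0A: "K0 \<subseteq> A" using K0(1) unfolding A_def by blast
  have "K0 \<noteq> {}" using K0_big by auto
  then obtain k0 where k0: "k0 \<in> U" "k0 \<in> A" using K0A K0(1) by blast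
  have "w \<notin> A" using w by (simp add: A_def)
  obtain u z where u: "u \<in> A" and z: "z \<in> U" "z \<notin> A" "adj u z"
    by (rule conn_edge[of U k0 "\<lambda>x. x \<in> A" w, OF conn_U k0 w(1) \<open>w \<notin> A\<close>])
  have uU: "u \<in> U" using u by (auto simp: A_def)
  define D where "D = K0 - nbs u - {u}"
  have "\<not> K0 \<subseteq> D \<union> {u}"
  proof
    assume "K0 \<subseteq> D \<union> {u}"
    from card_mono[OF _ this] have "card K0 \<le> card (D \<union> {u})"
      using finite_K0 by (simp add: D_def)
    also have "\<dots> \<le> card D + 1" using card_Un_le[of D "{u}"] by simp
    finally show False using u K0_big by (auto simp: A_def D_def)
  qed
  then obtain k where k: "k \<in> K0" "k \<noteq> u" "adj u k" by (auto simp: D_def)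
  have con: "conn ((U - {u}) \<inter> nbs u)" using conn_del[OF uU] by (rule conn_nbs) simp
  have kz: "k \<in> (U - {u}) \<inter> nbs u" "k \<in> A" "z \<in> (U - {u}) \<inter> nbs u"
    using k K0A K0(1) z u by auto
  obtain a z' where a': "a \<in> (U - {u}) \<inter> nbs u" and z'': "z' \<in> (U - {u}) \<inter> nbs u"
    and aA: "a \<in> A" "z' \<notin> A" and az: "adj a z'"
    by (rule conn_edge[of _ k "\<lambda>x. x \<in> A" z, OF con kz z(2)])
  have a: "a \<in> A" "adj u a" "a \<noteq> u" and z': "z' \<in> U" "z' \<notin> A" "adj u z'" "adj a z'"
    using a' z'' aA az by auto
  \<comment> \<open>A clique containing \<open>u\<close> and \<open>a\<close>, hence two neighbours
    of \<open>z'\<close>, and nearly all of \<open>K0\<close>.\<close>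
  define Q where "Q = (K0 \<inter> (nbs u \<union> {u}) \<inter> (nbs a \<union> {a})) \<union> {u, a}"
  have "clique Q"
    unfolding clique_def
  proof (intro ballI impI)
    fix x y assume "x \<in> Q" "y \<in> Q" "x \<noteq> y"
    then show "adj x y"
      using cliqueD[OF K0(2), of x y] a(2) adj_sym[of u a] adj_sym[of u x] adj_sym[of a x]
      by (auto simp: Q_def)
  qed
  moreover have finQ: "finite Q" using finite_K0 by (simp add: Q_def)
  moreover have "z' \<notin> Q" using z' u a K0A by (auto simp: Q_def)
  moreover have "{u, a} \<subseteq> Q \<inter> nbs z'" using z' adj_sym by (auto simp: Q_def)
  then have "card {u, a} \<le> card (Q \<inter> nbs z')" using finQ by (intro card_mono) auto
  then have "2 \<le> card (Q \<inter> nbs z')" using a by simp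
  ultimately have *: "card (Q - nbs z') \<le> 2" by (rule few_missed)
  \<comment> \<open>What \<open>z'\<close> misses in \<open>K0\<close> is missed by
    \<open>u\<close>, missed by \<open>a\<close>, or lies in \<open>Q\<close>: at most 2 + 2 + 2
    vertices. So \<open>z'\<close> sees two vertices of \<open>K0\<close>, and
    \<open>few_missed\<close> applies to \<open>K0\<close> itself.\<close>
  let ?M = "(K0 - nbs u - {u}) \<union> (K0 - nbs a - {a}) \<union> (Q - nbs z')"
  have "K0 - nbs z' \<subseteq> ?M" by (auto simp: Q_def)
  then have "card (K0 - nbs z') \<le> card ?M" using finite_K0 finQ by (intro card_mono) auto
  also have "\<dots> \<le> card (K0 - nbs u - {u}) + card (K0 - nbs a - {a}) + card (Q - nbs z')"
    by (meson add_le_mono1 card_Un_le le_trans)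
  also have "\<dots> \<le> 6" using * u a by (auto simp: A_def)
  finally have "2 \<le> card (K0 \<inter> nbs z')" using K0_big card_Int_Diff[OF finite_K0, of "nbs z'"] by simp
  moreover have "z' \<notin> K0" using z' K0A by auto
  ultimately have "card (K0 - nbs z') \<le> 2" using K0(2) finite_K0 few_missed by blast
  moreover have "K0 - nbs z' - {z'} = K0 - nbs z'" using \<open>z' \<notin> K0\<close> by auto
  ultimately show False using z' by (simp add: A_def)
qed

section \<open>The missed sets of the vertices outside the maximum clique\<close>

lemma card_miss_le: "w \<in> F \<Longrightarrow> card (miss w) \<le> 2"
proof -
  assume w: "w \<in> F"
  then have "K0 - nbs w - {w} = miss w" by (auto simp: F_def miss_def)
  with card_miss_U[of w] w show ?thesis by (simp add: F_def)
qed

text \<open>Otherwise \<open>w\<close> would extend the maximum clique.\<close>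

lemma miss_nonempty:
  assumes w: "w \<in> F"
  shows "miss w \<noteq> {}"
proof
  assume "miss w = {}"
  then have "clique (insert w K0)" using K0(2) adj_sym unfolding clique_def miss_def by auto
  then have "card (insert w K0) \<le> card K0" using w K0(1) by (intro K0_max) (auto simp: F_def)
  then show False using w finite_K0 by (auto simp: F_def)
qed

text \<open>If \<open>x\<close> is missed only by \<open>w\<close> and \<open>y\<close> only by
  \<open>w'\<close>, then \<open>w\<close>, \<open>y\<close>, \<open>x\<close>, \<open>w'\<close> is
  an induced 4-cycle.\<close>

lemma miss_comparable:
  assumes w: "w \<in> F" "w' \<in> F" "adj w w'"
  shows "miss w \<subseteq> miss w' \<or> miss w' \<subseteq> miss w"
proof (rule ccontr)
  assume "\<not> ?thesis"
  then obtain x y where xy: "x \<in> miss w" "x \<notin> miss w'" "y \<in> miss w'" "y \<notin> miss w" by auto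
  then have "y = w'"
    using K0(2) w adj_sym[of w w'] adj_sym[of w' x] adj_sym[of w' y] unfolding clique_def miss_def F_def
    by (intro no_C4[of w y x w']) (auto dest: adj_sym)
  then show False using xy w by (auto simp: miss_def F_def)
qed

text \<open>The missed sets of a clique form a chain, so one of maximum size contains the
  others.\<close>

lemma clique_F_dominated:
  assumes K: "K \<subseteq> F" "clique K" "K \<noteq> {}"
  obtains w where "w \<in> K" "\<And>w'. w' \<in> K \<Longrightarrow> miss w' \<subseteq> miss w"
proof -
  have fin: "finite K" using K(1) finite_U by (auto simp: F_def intro: finite_subset)
  have "finite ((\<lambda>w. card (miss w)) ` K)" "(\<lambda>w. card (miss w)) ` K \<noteq> {}" using fin K by auto
  then have "Max ((\<lambda>w. card (miss w)) ` K) \<in> (\<lambda>w. card (miss w)) ` K" by (rule Max_in)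
  then obtain w where w: "w \<in> K" "card (miss w) = Max ((\<lambda>w. card (miss w)) ` K)" by auto
  have "miss w' \<subseteq> miss w" if w': "w' \<in> K" for w'
  proof (cases "w' = w")
    case False
    then have "miss w \<subseteq> miss w' \<or> miss w' \<subseteq> miss w"
      using K w w' by (intro miss_comparable) (auto simp: clique_def)
    moreover have "card (miss w') \<le> card (miss w)" using w(2) w' fin by simp
    ultimately show ?thesis using card_seteq[of "miss w'" "miss w"] by auto
  qed simp
  with w that show ?thesis by blast
qed

lemma clique_swap:
  assumes K: "K \<subseteq> F" "clique K" and M: "\<And>w. w \<in> K \<Longrightarrow> miss w \<subseteq> M"
  shows "clique ((K0 - M) \<union> K)"
proof -
  have "adj w x" if "w \<in> K" "x \<in> K0 - M" for w x using M[of w] that by (auto simp: miss_def)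
  then show ?thesis using K(2) K0(2) adj_sym unfolding clique_def by blast
qed

text \<open>Exchange the largest missed set, of size at most two, for \<open>K\<close>: the result
  is a clique, and by maximality \<open>K\<close> is no larger than what it replaces.\<close>

lemma card_clique_F: "K \<subseteq> F \<Longrightarrow> clique K \<Longrightarrow> card K \<le> 2"
proof (cases "K = {}")
  case False
  assume K: "K \<subseteq> F" "clique K"
  from clique_F_dominated[OF K False] obtain w
    where w: "w \<in> K" "\<And>w'. w' \<in> K \<Longrightarrow> miss w' \<subseteq> miss w" by blast
  let ?K = "(K0 - miss w) \<union> K"
  have fin: "finite K" using K(1) finite_U by (auto simp: F_def intro: finite_subset)
  have "card ?K \<le> card K0" using clique_swap[OF K w(2)] K K0(1) by (intro K0_max) (auto simp: F_def)
  moreover have "card ?K = card (K0 - miss w) + card K"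
    using fin finite_K0 K(1) by (intro card_Un_disjoint) (auto simp: F_def)
  moreover have "card (K0 - miss w) = card K0 - card (miss w)"
    by (rule card_Diff_subset) (auto simp: miss_def finite_K0)
  ultimately show ?thesis using card_miss_le[of w] w K K0_big by auto
qed simp

text \<open>Replacing \<open>M\<close> by \<open>K\<close> in \<open>K0\<close> gives a clique which no vertex may miss in three places.\<close>

lemma no_three_missed:
  assumes K: "K \<subseteq> F" "clique K" and M: "\<And>w. w \<in> K \<Longrightarrow> miss w \<subseteq> M" "card M \<le> 2" "finite M"
    and w: "w \<in> F" "w \<notin> K" and T: "T \<subseteq> (miss w - M) \<union> (K - nbs w)" "card T = 3"
  shows False
proof -
  let ?K = "(K0 - M) \<union> K"
  have finK: "finite ?K" using K(1) finite_U finite_K0 by (auto simp: F_def intro: finite_subset)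
  \<comment> \<open>At most two vertices of \<open>K0\<close> are missed by \<open>w\<close> and at
    most two are exchanged, so \<open>w\<close> still sees two vertices of the new clique.\<close>
  have "card K0 \<le> card ((?K \<inter> nbs w) \<union> (miss w \<union> M))"
    using finK M(3) by (intro card_mono) (auto simp: miss_def)
  also have "\<dots> \<le> card (?K \<inter> nbs w) + (card (miss w) + card M)"
    by (meson add_le_mono card_Un_le le_refl le_trans)
  finally have "2 \<le> card (?K \<inter> nbs w)" using card_miss_le[OF w(1)] M(2) K0_big by simp
  then have "card (?K - nbs w) \<le> 2"
    using clique_swap[OF K M(1)] finK w by (intro few_missed) (auto simp: F_def)
  moreover have "card T \<le> card (?K - nbs w)"
    using T(1) finK by (intro card_mono) (auto simp: miss_def)
  ultimately show False using T(2) by simp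
qed

text \<open>If the sets were disjoint, exchanging \<open>miss w'\<close> for \<open>w'\<close> would
  give a clique in which \<open>w\<close> misses \<open>w'\<close> and both elements of
  \<open>miss w\<close>.\<close>

lemma pairs_meet:
  assumes w: "w \<in> F" "w' \<in> F" and two: "card (miss w) = 2"
  shows "miss w \<inter> miss w' \<noteq> {}"
proof
  assume disj: "miss w \<inter> miss w' = {}"
  have "w \<noteq> w'" using disj miss_nonempty[OF w(1)] by auto
  have "\<not> adj w w'" using miss_comparable[OF w] disj miss_nonempty w by blast
  show False
  proof (rule no_three_missed[of "{w'}" "miss w'" w "insert w' (miss w)"])
    have "w' \<notin> miss w" using w by (auto simp: miss_def F_def)
    then show "card (insert w' (miss w)) = 3" using two by simp
  qed (use disj \<open>w \<noteq> w'\<close> \<open>\<not> adj w w'\<close> card_miss_le w in \<open>auto simp: clique_def\<close>)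
qed

text \<open>A missed set with two elements meets all others and can serve as \<open>R\<close>; if
  there is none, \<open>R\<close> is empty.\<close>

lemma common_missed:
  obtains R where "R \<subseteq> K0" "card R \<le> 2" "\<And>w. w \<in> F \<Longrightarrow> card (miss w - R) \<le> 1"
proof (cases "\<exists>v\<in>F. card (miss v) = 2")
  case True
  then obtain v where v: "v \<in> F" "card (miss v) = 2" by auto
  show ?thesis
  proof (rule that[of "miss v"])
    fix w assume w: "w \<in> F"
    have "card (miss w) = card (miss w \<inter> miss v) + card (miss w - miss v)"
      by (rule card_Int_Diff) simp
    moreover have "card (miss w \<inter> miss v) > 0"
      using pairs_meet[OF v(1) w v(2)] by (simp add: card_gt_0_iff Int_commute)
    ultimately show "card (miss w - miss v) \<le> 1" using card_miss_le[OF w] by simp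
  qed (use v in \<open>auto simp: miss_def\<close>)
next
  case False
  show ?thesis
  proof (rule that[of "{}"])
    fix w assume "w \<in> F"
    then show "card (miss w - {}) \<le> 1" using False card_miss_le[of w] by force
  qed auto
qed

text \<open>Outside \<open>R\<close> each missed set is empty or a singleton, so by comparability
  adjacent vertices can disagree only as empty against singleton, a \<open>mixed\<close> edge.
  Without mixed edges \<open>R\<close> suffices. If only one singleton \<open>{y}\<close> occurs,
  \<open>y\<close> is deleted too. Otherwise all mixed edges share their empty end, which is deleted
  instead.\<close>

lemma deletion_set:
  obtains X where "X \<subseteq> U" "card X \<le> 3" "\<And>w. w \<in> F - X \<Longrightarrow> card (miss w - X) \<le> 1"
    "\<And>w w'. w \<in> F - X \<Longrightarrow> w' \<in> F - X \<Longrightarrow> adj w w' \<Longrightarrow> miss w - X = miss w' - X"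
proof -
  obtain R where R: "R \<subseteq> K0" "card R \<le> 2" and le1: "\<And>w. w \<in> F \<Longrightarrow> card (miss w - R) \<le> 1"
    using common_missed by blast
  have finR: "finite R" using R(1) finite_K0 by (rule finite_subset)
  have single: "miss w - R = {y}" if "w \<in> F" "y \<in> miss w - R" for w y
    using le1[OF that(1)] that(2) by (intro card_le_1_singleton) auto
  define mixed where "mixed u u' y \<longleftrightarrow>
    u \<in> F \<and> u' \<in> F \<and> adj u u' \<and> miss u - R = {} \<and> miss u' - R = {y}" for u u' y
  have mixedI: "\<exists>y. mixed u u' y \<or> mixed u' u y"
    if "u \<in> F" "u' \<in> F" "adj u u'" "miss u - R \<noteq> miss u' - R" for u u'
  proof -
    from that(4) obtain y where y: "y \<in> miss u - R \<and> y \<notin> miss u' \<or> y \<in> miss u' - R \<and> y \<notin> miss u"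
      by blast
    then show ?thesis
    proof
      assume y: "y \<in> miss u - R \<and> y \<notin> miss u'"
      then have "miss u' \<subseteq> miss u" using miss_comparable[OF that(1-3)] by blast
      moreover have "miss u - R = {y}" using single that y by blast
      ultimately have "miss u' - R \<subseteq> {y} - {y}" using y by blast
      then have "miss u' - R = {}" by simp
      then show ?thesis using that \<open>miss u - R = {y}\<close> adj_sym unfolding mixed_def by blast
    next
      assume y: "y \<in> miss u' - R \<and> y \<notin> miss u"
      then have "miss u \<subseteq> miss u'" using miss_comparable[OF that(1-3)] by blast
      moreover have "miss u' - R = {y}" using single that y by blast
      ultimately have "miss u - R \<subseteq> {y} - {y}" using y by blast
      then have "miss u - R = {}" by simp
      then show ?thesis using that \<open>miss u' - R = {y}\<close> unfolding mixed_def by blast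
    qed
  qed
  have far: "\<not> adj w w'" if "w \<in> F" "w' \<in> F" "miss w - R = {y}" "miss w' - R = {y'}" "y \<noteq> y'"
    for w w' y y'
  proof
    assume "adj w w'"
    have "y \<in> miss w - R" "y' \<in> miss w' - R" "y \<notin> miss w' - R" "y' \<notin> miss w - R"
      using that(3-5) by simp_all
    then show False using miss_comparable[OF that(1,2) \<open>adj w w'\<close>] by blast
  qed
  \<comment> \<open>Otherwise exchange \<open>miss u'\<close> for \<open>{u, u'}\<close>: in the
    resulting clique \<open>w\<close> misses \<open>y'\<close>, \<open>u\<close> and
    \<open>u'\<close>.\<close>
  have mixed_adj: "adj u w"
    if mix: "mixed u u' y" and w: "w \<in> F" "miss w - R = {y'}" "y' \<noteq> y" for u u' y w y'
  proof (rule ccontr)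
    assume "\<not> adj u w"
    have u: "u \<in> F" "u' \<in> F" "adj u u'" "miss u - R = {}" "miss u' - R = {y}"
      using mix by (auto simp: mixed_def)
    have sub: "miss u \<subseteq> miss u'" using miss_comparable[OF u(1-3)] u(4,5) by blast
    have "\<not> adj u' w" using far[OF u(2) w(1) u(5) w(2)] w(3) by auto
    have ne: "u \<noteq> u'" "w \<noteq> u" "w \<noteq> u'" using u w by auto
    have y': "y' \<in> miss w" "y' \<notin> miss u'" using u w by auto
    show False
    proof (rule no_three_missed[of "{u, u'}" "miss u'" w "{y', u, u'}"])
      have "y' \<in> K0" "u \<notin> K0" "u' \<notin> K0" using y' u(1,2) by (simp_all add: miss_def F_def)
      then show "card {y', u, u'} = 3" using ne(1) by (auto simp: card_insert_if)
      show "clique {u, u'}" using u(3) adj_sym by (auto simp: clique_def)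
      show "{y', u, u'} \<subseteq> (miss w - miss u') \<union> ({u, u'} - nbs w)"
        using y' \<open>\<not> adj u w\<close> \<open>\<not> adj u' w\<close> adj_sym by auto
    qed (use u w ne sub card_miss_le in auto)
  qed
  show ?thesis
  proof (cases "\<exists>u u' y. mixed u u' y")
    case False
    show ?thesis
    proof (rule that[of R])
      show "miss w - R = miss w' - R" if "w \<in> F - R" "w' \<in> F - R" "adj w w'" for w w'
        using mixedI[of w w'] that False by blast
    qed (use R K0 le1 in auto)
  next
    case True
    then obtain u0 u1 y where mix: "mixed u0 u1 y" by blast
    then have u: "u0 \<in> F" "u1 \<in> F" "adj u0 u1" "miss u0 - R = {}" "miss u1 - R = {y}"
      by (auto simp: mixed_def)
    show ?thesis
    proof (cases "\<exists>w\<in>F. \<not> miss w - R \<subseteq> {y}")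
      case False
      have *: "miss w - insert y R = {}" if "w \<in> F" for w using False that by blast
      show ?thesis
      proof (rule that[of "insert y R"])
        show "insert y R \<subseteq> U" using R K0(1) u by (auto simp: miss_def)
        show "card (insert y R) \<le> 3" using R finR by (simp add: card_insert_if)
      qed (auto simp: *)
    next
      case True
      then obtain w1 y1 where w1: "w1 \<in> F" "y1 \<in> miss w1 - R" "y1 \<noteq> y" by blast
      then have w1': "miss w1 - R = {y1}" using single by blast
      have mix1: "mixed u0 w1 y1"
        using mixed_adj[OF mix w1(1) w1' w1(3)] u w1 w1' by (auto simp: mixed_def)
      \<comment> \<open>Every singleton differs from \<open>{y}\<close> or from \<open>{y1}\<close>,
        so one of the two mixed edges at \<open>u0\<close> applies.\<close>
      have all: "adj u0 w" if "w \<in> F" "miss w - R = {z}" for w z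
        using mixed_adj[OF mix that] mixed_adj[OF mix1 that] w1(3) by blast
      \<comment> \<open>A second empty end \<open>u\<close> shares with \<open>u0\<close> the
        nonadjacent neighbours \<open>u'\<close> and \<open>w\<close>. As there is no induced
        4-cycle, \<open>u0\<close> sees \<open>u\<close>, and \<open>u0\<close>, \<open>u\<close>,
        \<open>u'\<close> is a triangle outside \<open>K0\<close>, against
        \<open>card_clique_F\<close>.\<close>
      have unique: "u = u0" if "mixed u u' z" for u u' z
      proof (rule ccontr)
        assume "u \<noteq> u0"
        from that have u': "u \<in> F" "u' \<in> F" "adj u u'" "miss u - R = {}" "miss u' - R = {z}"
          by (auto simp: mixed_def)
        obtain w z' where w: "w \<in> F" "miss w - R = {z'}" "z' \<noteq> z"
          using u(2,5) w1(1,3) w1' by metis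
        have adjs: "adj u0 u'" "adj u0 w" "adj u w"
          using all u' w mixed_adj[OF that w] by blast+
        have "u' \<noteq> w" using u' w by auto
        have "adj u0 u"
        proof (rule ccontr)
          assume "\<not> adj u0 u"
          then have "u' = w"
            using adjs u'(3) adj_sym \<open>u \<noteq> u0\<close> far[OF u'(2) w(1) u'(5) w(2)] w(3)
            by (intro no_C4[of u0 u' u w]) auto
          with \<open>u' \<noteq> w\<close> show False ..
        qed
        then have "card {u0, u, u'} \<le> 2"
          using adjs u'(1-3) u(1) adj_sym by (intro card_clique_F) (auto simp: clique_def)
        moreover have "u0 \<noteq> u" "u0 \<noteq> u'" "u \<noteq> u'" using \<open>u \<noteq> u0\<close> adjs u' u by auto
        ultimately show False by simp
      qed
      have u0K: "u0 \<notin> K0" using u by (auto simp: F_def)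
      have *: "miss w - insert u0 R = miss w - R" for w using u0K by (auto simp: miss_def)
      show ?thesis
      proof (rule that[of "insert u0 R"])
        show "insert u0 R \<subseteq> U" using R K0(1) u by (auto simp: F_def)
        show "card (insert u0 R) \<le> 3" using R finR by (simp add: card_insert_if)
        show "miss w - insert u0 R = miss w' - insert u0 R"
          if "w \<in> F - insert u0 R" "w' \<in> F - insert u0 R" "adj w w'" for w w'
          using mixedI[of w w'] that unique unfolding * by blast
      qed (use le1 * in auto)
    qed
  qed
qed

text \<open>After the deletion, the groups \<open>G y\<close>, consisting of \<open>y\<close> and
  the vertices that miss exactly \<open>y\<close>, are added one at a time, and the vertices missing
  nothing come last. Restoring up to three deleted vertices gives the bound
  \<open>2 ^ 3 * 5\<close>.\<close>

lemma dec_U: "dec 40 U U"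
proof -
  obtain X where X: "X \<subseteq> U" "card X \<le> 3" and le1: "\<And>w. w \<in> F - X \<Longrightarrow> card (miss w - X) \<le> 1"
    and same: "\<And>w w'. w \<in> F - X \<Longrightarrow> w' \<in> F - X \<Longrightarrow> adj w w' \<Longrightarrow> miss w - X = miss w' - X"
    using deletion_set by blast
  have finX: "finite X" using X(1) finite_U by (rule finite_subset)
  define W where "W = U - X"
  define part where "part P = {w \<in> F - X. miss w - X = P}" for P
  have "dec (2 ^ 2) (F - X) (part P)" for P
  proof (rule dec_if_small_cliques)
    show "finite (F - X)" using finite_U by (simp add: F_def)
    show "nbs x \<inter> (F - X - part P) \<subseteq> {}" if "x \<in> part P" for x
    proof
      fix y assume y: "y \<in> nbs x \<inter> (F - X - part P)"
      with that have "miss x - X = miss y - X" by (intro same) (auto simp: part_def)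
      then show "y \<in> {}" using that y by (auto simp: part_def)
    qed
    show "card K \<le> 2" if "K \<subseteq> F - X" "clique K" for K
      using that by (intro card_clique_F) auto
  qed (auto simp: part_def clique_def)
  then have "dec (2 ^ 2) W (part P)" for P
  proof (rule dec_transfer)
    show "F - X \<subseteq> W" by (auto simp: W_def F_def)
    show "nbs v \<inter> (W - (F - X)) = K0 - X - P" if "v \<in> part P" for v
      using that K0(1) by (auto simp: W_def F_def part_def miss_def)
  qed (auto simp: part_def)
  then have part: "dec 5 W (part P)" for P by (rule dec_mono) simp
  define G where "G y = insert y (part {y})" for y
  have disjG: "G y \<inter> G z = {}" if "y \<noteq> z" "y \<in> K0" "z \<in> K0" for y z
    using that by (auto simp: G_def part_def F_def)
  \<comment> \<open>A vertex of \<open>W\<close> that does not see \<open>y\<close> misses exactly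
    \<open>y\<close> and therefore already lies in \<open>G y\<close>.\<close>
  have nbsG: "nbs y \<inter> (W - Z) = W - Z" if y: "y \<in> K0 - X" and GZ: "G y \<subseteq> Z" for y Z
  proof -
    have "adj y w" if w: "w \<in> W - Z" for w
    proof (cases "w \<in> K0")
      case True
      then show ?thesis using K0(2) y GZ w by (auto simp: clique_def G_def)
    next
      case False
      then have wF: "w \<in> F - X" using w by (auto simp: F_def W_def)
      have "y \<notin> miss w"
      proof
        assume "y \<in> miss w"
        then have "miss w - X = {y}" using le1[OF wF] y by (intro card_le_1_singleton) auto
        then show False using wF w GZ by (auto simp: G_def part_def)
      qed
      then show ?thesis using y adj_sym[of w y] by (auto simp: miss_def)
    qed
    then show ?thesis by auto
  qed
  \<comment> \<open>Only two types arise: the vertices of \<open>J\<close> see everything outside,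
    and those missing one of them see exactly the remaining vertices of \<open>K0\<close>.\<close>
  have typesG: "card (types W (\<Union>y\<in>J. G y)) \<le> 2" if J: "J \<subseteq> K0 - X" for J
  proof -
    let ?Z = "\<Union>y\<in>J. G y"
    have "nbs v \<inter> (W - ?Z) \<in> {W - ?Z, K0 - X - J}" if v: "v \<in> ?Z" for v
    proof -
      obtain y where y: "y \<in> J" "v \<in> G y" using v by auto
      show ?thesis
      proof (cases "v = y")
        case True
        then show ?thesis using nbsG[of y ?Z] y J by auto
      next
        case False
        then have v': "v \<in> F - X" "miss v - X = {y}" using y by (auto simp: G_def part_def)
        have "nbs v \<inter> (W - ?Z) = K0 - X - J"
        proof (intro set_eqI iffI)
          fix x assume x: "x \<in> nbs v \<inter> (W - ?Z)"
          have "x \<in> K0"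
          proof (rule ccontr)
            assume "x \<notin> K0"
            then have "x \<in> part {y}" using x v' same[of v x] by (auto simp: part_def W_def F_def)
            then show False using x y by (auto simp: G_def)
          qed
          then show "x \<in> K0 - X - J" using x by (auto simp: W_def G_def)
        next
          fix x assume x: "x \<in> K0 - X - J"
          then have "x \<notin> G z" if "z \<in> J" for z using that J by (auto simp: G_def part_def F_def)
          moreover have "adj v x" using x v' y by (auto simp: miss_def)
          ultimately show "x \<in> nbs v \<inter> (W - ?Z)" using x K0(1) by (auto simp: W_def)
        qed
        then show ?thesis by simp
      qed
    qed
    then have "types W ?Z \<subseteq> {W - ?Z, K0 - X - J}" by (auto simp: types_def)
    from card_mono[OF _ this] show ?thesis by (simp add: card_insert_if split: if_splits)
  qed
  have decG: "dec 5 W (G y)" if y: "y \<in> K0 - X" for y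
  proof -
    have "card (types W ({y} \<union> part {y})) \<le> 5" using typesG[of "{y}"] y by (simp add: G_def)
    moreover have "{y} \<inter> part {y} = {}" using y by (auto simp: part_def F_def)
    ultimately have "dec 5 W ({y} \<union> part {y})" using part by (intro dec_Un dec_single) auto
    then show ?thesis by (simp add: G_def)
  qed
  have "finite J \<Longrightarrow> J \<subseteq> K0 - X \<Longrightarrow> dec 5 W (\<Union>y\<in>J. G y)" for J
  proof (induction J rule: finite_induct)
    case empty
    then show ?case by (simp add: dec_empty)
  next
    case (insert y J)
    have "G y \<inter> G z = {}" if "z \<in> J" for z using that insert by (intro disjG) auto
    then have "dec 5 W (G y \<union> (\<Union>y\<in>J. G y))"
      using insert typesG[of "insert y J"] by (intro dec_Un decG) auto
    then show ?case by simp
  qed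
  from this[of "K0 - X"] have "dec 5 W (\<Union>y\<in>K0 - X. G y)" using finite_K0 by simp
  moreover have "part {} \<inter> (\<Union>y\<in>K0 - X. G y) = {}" by (auto simp: part_def G_def F_def)
  moreover have W: "part {} \<union> (\<Union>y\<in>K0 - X. G y) = W"
  proof (intro set_eqI iffI)
    fix w assume "w \<in> part {} \<union> (\<Union>y\<in>K0 - X. G y)"
    then show "w \<in> W" using K0(1) by (auto simp: part_def G_def W_def F_def)
  next
    fix w assume w: "w \<in> W"
    show "w \<in> part {} \<union> (\<Union>y\<in>K0 - X. G y)"
    proof (cases "w \<in> K0 \<or> miss w - X = {}")
      case True
      then show ?thesis using w by (auto simp: part_def G_def W_def F_def)
    next
      case False
      then obtain y where y: "y \<in> miss w - X" by auto
      have wF: "w \<in> F - X" using False w by (auto simp: W_def F_def)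
      have "miss w - X = {y}" using le1[OF wF] y by (intro card_le_1_singleton) auto
      then have "w \<in> G y" using wF by (auto simp: G_def part_def)
      then show ?thesis using y by (auto simp: miss_def)
    qed
  qed
  ultimately have "dec 5 W W"
    using dec_Un[OF part[of "{}"], of "\<Union>y\<in>K0 - X. G y"] card_types_self[of W] by simp
  then have "dec (2 ^ card X * 5) (W \<union> X) (W \<union> X)" using finX by (intro dec_add_vertices) auto
  moreover have "W \<union> X = U" using X by (auto simp: W_def)
  moreover have "(2::nat) ^ card X \<le> 2 ^ 3" using X(2) by (intro power_increasing) auto
  ultimately show ?thesis by (auto intro: dec_mono)
qed

end

section \<open>Blocks\<close>

context thin_chordal
begin

text \<open>In a chordal graph the maximal sets of this kind are the usual blocks.\<close>

inductive block :: "'a set \<Rightarrow> bool" where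
  block_edge: "adj a b \<Longrightarrow> block {a, b}"
| block_insert: "block B \<Longrightarrow> d \<notin> B \<Longrightarrow> b \<in> B \<Longrightarrow> b' \<in> B \<Longrightarrow> b \<noteq> b' \<Longrightarrow> adj d b \<Longrightarrow> adj d b' \<Longrightarrow>
    block (insert d B)"

section \<open>Blocks are 2-connected and have splittings of bounded width\<close>

lemma block_finite: "block B \<Longrightarrow> finite B"
  by (induction rule: block.induct) auto

lemma block_card: "block B \<Longrightarrow> 2 \<le> card B"
proof (induction rule: block.induct)
  case (block_edge a b)
  then have "a \<noteq> b" using adj_irrefl by auto
  then show ?case by simp
next
  case (block_insert B d b b')
  then show ?case using block_finite[of B] by simp
qed

lemma block_conn: "block B \<Longrightarrow> conn B"
proof (induction rule: block.induct)
  case (block_edge a b)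
  then show ?case by (intro conn_insert[of _ b] conn_singleton) auto
next
  case (block_insert B d b b')
  then show ?case using conn_insert by blast
qed

lemma block_conn_del: "block B \<Longrightarrow> x \<in> B \<Longrightarrow> conn (B - {x})"
proof (induction rule: block.induct)
  case (block_edge a b)
  then have "a \<noteq> b" using adj_irrefl by auto
  with block_edge have "{a, b} - {x} = {a} \<or> {a, b} - {x} = {b}" by auto
  then show ?case using conn_singleton by metis
next
  case (block_insert B d b b')
  show ?case
  proof (cases "x = d")
    case True
    then show ?thesis using block_conn block_insert.hyps by simp
  next
    case False
    then have "conn (B - {x})" using block_insert by simp
    moreover obtain c where "c \<in> B - {x}" "adj d c" using block_insert.hyps by (cases "b = x") auto
    ultimately have "conn (insert d (B - {x}))" by (rule conn_insert)
    then show ?thesis using False by (simp add: insert_Diff_if)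
  qed
qed

text \<open>A clique of size 10 leads to the bound 40 of \<open>dec_U\<close>; otherwise cliques
  have at most 9 vertices, and \<open>2 ^ 9 = 512\<close>.\<close>

lemma block_dec:
  assumes B: "block B"
  shows "dec 512 B B"
proof (cases "\<exists>K\<subseteq>B. clique K \<and> card K \<ge> 10")
  case True
  let ?P = "\<lambda>K. K \<subseteq> B \<and> clique K"
  have finB: "finite B" using B by (rule block_finite)
  obtain K where K: "K \<subseteq> B" "clique K" "card K \<ge> 10" using True by blast
  have "\<forall>K. ?P K \<longrightarrow> card K < Suc (card B)"
    using card_mono[OF finB] by (simp add: less_Suc_eq_le)
  with K have "\<exists>K0. ?P K0 \<and> (\<forall>K. ?P K \<longrightarrow> card K \<le> card K0)"
    by (intro ex_has_greatest_nat[of ?P K]) auto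
  then obtain K0 where K0: "K0 \<subseteq> B" "clique K0" "\<And>K. K \<subseteq> B \<Longrightarrow> clique K \<Longrightarrow> card K \<le> card K0"
    by blast
  interpret big_block adj B K0
    using finB block_conn[OF B] block_conn_del[OF B] K0 K0(3)[OF K(1,2)] K(3)
    by unfold_locales auto
  show ?thesis using dec_U by (rule dec_mono) simp
next
  case False
  have "dec (2 ^ 9) B B"
  proof (rule dec_if_small_cliques)
    show "card K \<le> 9" if "K \<subseteq> B" "clique K" for K using False that by force
    show "clique {}" by (simp add: clique_def)
  qed (use block_finite[OF B] in auto)
  then show ?thesis by simp
qed

text \<open>\<open>H b\<close> hangs on the block \<open>B\<close> at its vertex \<open>b\<close>; the part of \<open>X\<close> belonging to a set
  \<open>Z\<close> of block vertices is built together with everything that hangs on \<open>Z\<close>.\<close>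

lemma dec_attach:
  assumes X: "X \<subseteq> V" "S \<subseteq> V - X" "card S \<le> 1" "finite S" "\<And>x. x \<in> X \<Longrightarrow> nbs x \<inter> (V - X) \<subseteq> S"
    and B: "B \<subseteq> X \<union> S" "S \<subseteq> B"
    and H: "\<And>b. b \<in> B \<Longrightarrow> dec (2 * k + 2) V (H b)" "\<And>b. b \<in> B \<Longrightarrow> H b \<subseteq> X - B"
      "\<And>b x. b \<in> B \<Longrightarrow> x \<in> H b \<Longrightarrow> nbs x \<inter> (V - H b) \<subseteq> {b}"
      "\<And>b c. b \<in> B \<Longrightarrow> c \<in> B \<Longrightarrow> b \<noteq> c \<Longrightarrow> H b \<inter> H c = {}"
    and cover: "X - B \<subseteq> (\<Union>b\<in>B. H b)"
    and D: "dec k B Z"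
  shows "Z \<subseteq> B \<Longrightarrow> dec (2 * k + 2) V ((Z - S) \<union> (\<Union>b\<in>Z. H b))"
proof -
  \<comment> \<open>A vertex of \<open>Z - S\<close> sees outside what it sees in
    \<open>B - Z\<close>, and possibly the vertex of \<open>S\<close>, which is never part of the
    piece: at most \<open>2 * k\<close> types. A hanging vertex can see at most the vertex of
    \<open>S\<close>: two more.\<close>
  have narrow: "card (types V ((Z - S) \<union> (\<Union>b\<in>Z. H b))) \<le> 2 * k + 2"
    if Z: "Z \<subseteq> B" "finite Z" "card (types B Z) \<le> k" for Z
  proof -
    let ?E = "(Z - S) \<union> (\<Union>b\<in>Z. H b)"
    have "nbs v \<inter> (V - ?E) \<in> (\<lambda>(A, T). A \<union> T) ` (types B Z \<times> Pow S) \<union> Pow S"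
      if v: "v \<in> ?E" for v
    proof (cases "v \<in> Z - S")
      case True
      have "nbs v \<inter> (V - ?E) = (nbs v \<inter> (B - Z)) \<union> (nbs v \<inter> (S \<inter> Z))"
      proof (intro set_eqI iffI)
        fix z assume z: "z \<in> nbs v \<inter> (V - ?E)"
        have vX: "v \<in> X" using True Z(1) B(1) by blast
        have "z \<in> B"
        proof (rule ccontr)
          assume "z \<notin> B"
          then have "z \<in> X" using X(5)[OF vX] z B(2) by blast
          then obtain b where b: "b \<in> B" "z \<in> H b" using cover \<open>z \<notin> B\<close> by blast
          have "v \<in> nbs z" using z adj_sym[of v z] by simp
          moreover have "v \<notin> H b" "v \<in> V" using H(2)[OF b(1)] True Z(1) vX X(1) by blast+
          ultimately have "v = b" using H(3)[OF b] by blast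
          then show False using b True z by blast
        qed
        then show "z \<in> (nbs v \<inter> (B - Z)) \<union> (nbs v \<inter> (S \<inter> Z))" using z by blast
      next
        fix z assume z: "z \<in> (nbs v \<inter> (B - Z)) \<union> (nbs v \<inter> (S \<inter> Z))"
        then have zB: "z \<in> B" using B(2) by blast
        have "z \<notin> H b" if "b \<in> Z" for b using H(2)[of b] that Z(1) zB by blast
        then show "z \<in> nbs v \<inter> (V - ?E)" using z zB B(1) X(1,2) by blast
      qed
      moreover have "nbs v \<inter> (B - Z) \<in> types B Z" using True by (auto simp: types_def)
      moreover have "nbs v \<inter> (S \<inter> Z) \<in> Pow S" by blast
      ultimately show ?thesis by (intro UnI1 image_eqI[of _ _ "(nbs v \<inter> (B - Z), nbs v \<inter> (S \<inter> Z))"]) auto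
    next
      case False
      then obtain b where b: "b \<in> Z" "v \<in> H b" using v by blast
      have "nbs v \<inter> (V - ?E) \<subseteq> S" using H(3)[of b v] b Z(1) by blast
      then show ?thesis by blast
    qed
    then have sub: "types V ?E \<subseteq> (\<lambda>(A, T). A \<union> T) ` (types B Z \<times> Pow S) \<union> Pow S"
      unfolding types_def[of V] by blast
    have "card (types V ?E) \<le> card ((\<lambda>(A, T). A \<union> T) ` (types B Z \<times> Pow S) \<union> Pow S)"
      using X(4) Z(2) finite_types[of Z B] by (intro card_mono[OF _ sub]) auto
    also have "\<dots> \<le> card ((\<lambda>(A, T). A \<union> T) ` (types B Z \<times> Pow S)) + card (Pow S)"
      by (rule card_Un_le)
    also have "\<dots> \<le> card (types B Z) * 2 ^ card S + 2 ^ card S"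
      using card_image_Un_Pow[OF finite_types[OF Z(2)] X(4)] X(4) by (simp add: card_Pow)
    also have "\<dots> \<le> k * 2 ^ 1 + 2 ^ 1"
      using Z(3) X(3) by (intro add_mono mult_mono power_increasing) auto
    finally show ?thesis by simp
  qed
  show "Z \<subseteq> B \<Longrightarrow> dec (2 * k + 2) V ((Z - S) \<union> (\<Union>b\<in>Z. H b))"
    using D
  proof (induction rule: dec.induct)
    case dec_empty
    then show ?case by (simp add: dec.dec_empty)
  next
    case (dec_single b)
    have "card (types B {b}) \<le> k" using dec_single by (simp add: types_def)
    then have "card (types V (({b} - S) \<union> H b)) \<le> 2 * k + 2" using narrow[of "{b}"] dec_single by simp
    moreover have "dec (2 * k + 2) V ({b} - S)"
      using dec.dec_empty dec.dec_single[of "2 * k + 2" V b]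
      by (cases "b \<in> S") (simp_all add: insert_Diff_if)
    moreover have "({b} - S) \<inter> H b = {}" using H(2)[of b] dec_single by blast
    ultimately have "dec (2 * k + 2) V (({b} - S) \<union> H b)"
      using H(1)[of b] dec_single by (intro dec_Un) auto
    then show ?case by simp
  next
    case (dec_Un Y Z)
    have fin: "finite (Y \<union> Z)" using dec_Un.hyps dec_finite by blast
    have "Y - S \<union> (\<Union>b\<in>Y. H b) \<union> (Z - S \<union> (\<Union>b\<in>Z. H b)) =
        (Y \<union> Z - S) \<union> (\<Union>b\<in>Y \<union> Z. H b)" by blast
    moreover have "(Y - S \<union> (\<Union>b\<in>Y. H b)) \<inter> (Z - S \<union> (\<Union>b\<in>Z. H b)) = {}"
    proof -
      have "H b \<inter> H c = {}" if "b \<in> Y" "c \<in> Z" for b c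
        using that dec_Un.hyps(3) dec_Un.prems by (intro H(4)) auto
      moreover have "H b \<inter> B = {}" if "b \<in> Y \<union> Z" for b
        using H(2)[of b] that dec_Un.prems by blast
      ultimately show ?thesis using dec_Un.hyps(3) dec_Un.prems by blast
    qed
    ultimately show ?case
      using dec.dec_Un[of "2 * k + 2" V "Y - S \<union> (\<Union>b\<in>Y. H b)" "Z - S \<union> (\<Union>b\<in>Z. H b)"]
        narrow[OF dec_Un.prems fin] dec_Un by simp
  qed
qed

text \<open>Induction on \<open>X\<close>, which hangs on at most one vertex. A connected
  \<open>X\<close> contains a largest block through its attachment vertex; what remains hangs on
  single vertices of this block and is smaller. With \<open>k = 512\<close>,
  \<open>dec_attach\<close> gives \<open>2 * 512 + 2 = 1026\<close>.\<close>

lemma dec_one_attachment: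
  assumes finV: "finite V"
  shows "X \<subseteq> V \<Longrightarrow> S \<subseteq> V - X \<Longrightarrow> card S \<le> 1 \<Longrightarrow> (\<And>x. x \<in> X \<Longrightarrow> nbs x \<inter> (V - X) \<subseteq> S) \<Longrightarrow>
    dec 1026 V X"
proof (induction "card X" arbitrary: X S rule: less_induct)
  case less
  note X = less.prems
  have finX: "finite X" and finS: "finite S"
    using X finV by (auto intro: finite_subset[OF _ finV])
  have "card (types V X) \<le> 2 ^ card S"
    using X finS by (intro card_types_le_power)
  also have "\<dots> \<le> 2 ^ 1" using X(3) by (intro power_increasing) auto
  finally have narrow: "card (types V X) \<le> 1026" by simp
  show ?case
  proof (cases "conn X")
    case False
    then obtain A where A: "A \<subseteq> X" "A \<noteq> {}" "A \<noteq> X"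
      and no: "\<And>a b. a \<in> A \<Longrightarrow> b \<in> X - A \<Longrightarrow> \<not> adj a b"
      by (rule not_connE) blast
    have "dec 1026 V A"
    proof (rule less.hyps)
      show "card A < card X" using A finX by (intro psubset_card_mono) auto
      show "nbs x \<inter> (V - A) \<subseteq> S" if "x \<in> A" for x
        using that A(1) X(4)[of x] no[of x] by (fastforce simp: nbs_def)
    qed (use A X in auto)
    moreover have "dec 1026 V (X - A)"
    proof (rule less.hyps)
      show "card (X - A) < card X" using A finX by (intro psubset_card_mono) auto
      show "nbs x \<inter> (V - (X - A)) \<subseteq> S" if "x \<in> X - A" for x
        using that A(1) X(4)[of x] no[of _ x] adj_sym by (fastforce simp: nbs_def)
    qed (use A X in auto)
    moreover have "A \<union> (X - A) = X" using A by auto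
    ultimately show ?thesis using dec_Un[of 1026 V A "X - A"] narrow by auto
  next
    case True
    let ?S = "{s \<in> S. \<exists>x\<in>X. adj x s}"
    have S': "?S \<subseteq> V - X" "card ?S \<le> 1" "finite ?S"
      using X(2,3) finS card_mono[of S ?S] by auto
    have nbsS: "nbs x \<inter> (V - X) \<subseteq> ?S" if "x \<in> X" for x using X(4)[OF that] that by auto
    show ?thesis
    \<comment> \<open>Such an edge starts a block containing the attachment vertex. If there is
      none, connectivity leaves at most one vertex in \<open>X\<close>.\<close>
    proof (cases "\<exists>a\<in>X. \<exists>b\<in>X \<union> ?S. adj a b \<and> ?S \<subseteq> {b}")
      case False
      have "X = {} \<or> (\<exists>x. X = {x})"
      proof (rule ccontr)
        assume "\<not> ?thesis"
        then obtain x y where xy: "x \<in> X" "y \<in> X" "x \<noteq> y" by blast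
        show False
        proof (cases "?S = {}")
          case True
          obtain x' y' where "x' \<in> X" "y' \<in> X" "adj x' y'"
            by (rule conn_edge[of X x "\<lambda>z. z = x" y, OF \<open>conn X\<close> xy(1) refl xy(2)]) (use xy in auto)
          then show False using False True by blast
        next
          case nonempty: False
          then obtain s where s: "s \<in> ?S" by blast
          have "{s} = ?S" by (rule card_seteq) (use s S'(2,3) in auto)
          then show False using False s by blast
        qed
      qed
      then show ?thesis by (auto intro: dec.intros)
    next
      case True
      then obtain a b where ab: "a \<in> X" "b \<in> X \<union> ?S" "adj a b" "?S \<subseteq> {b}" by blast
      let ?P = "\<lambda>B. block B \<and> B \<subseteq> X \<union> ?S \<and> ?S \<subseteq> B"
      have "?P {a, b}" using ab block_edge by auto
      moreover have "\<forall>B. ?P B \<longrightarrow> card B < Suc (card (X \<union> ?S))"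
        using card_mono[of "X \<union> ?S"] finX S'(3) by (simp add: less_Suc_eq_le)
      ultimately have "\<exists>B. ?P B \<and> (\<forall>C. ?P C \<longrightarrow> card C \<le> card B)"
        by (rule ex_has_greatest_nat)
      then obtain B where blk: "block B" and B: "B \<subseteq> X \<union> ?S" "?S \<subseteq> B"
        and max: "\<And>C. ?P C \<Longrightarrow> card C \<le> card B" by blast
      have finB: "finite B" using blk by (rule block_finite)
      \<comment> \<open>This makes every hanging part a proper subset of \<open>X\<close>, as the
        induction needs.\<close>
      have BX: "B \<inter> X \<noteq> {}"
      proof
        assume "B \<inter> X = {}"
        then have "B \<subseteq> ?S" using B by blast
        then have "card B \<le> card ?S" using S'(3) by (intro card_mono) auto
        then show False using block_card[OF blk] S'(2) by simp
      qed
      have single_attachment: "b = b'"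
        if D: "conn D" "D \<subseteq> X - B" and d: "d \<in> D" "adj d b" "d' \<in> D" "adj d' b'"
          and bb: "b \<in> B" "b' \<in> B" for D d d' b b'
      proof (rule ccontr)
        assume "b \<noteq> b'"
        \<comment> \<open>If \<open>D\<close> touches \<open>b\<close> and \<open>b'\<close>, it
          stays connected to the block without \<open>b\<close>. The neighbours of \<open>b\<close>
          in this union are connected, so an edge \<open>e c\<close> among them goes from
          \<open>D\<close> to \<open>B\<close>; now \<open>e\<close> sees both \<open>b\<close> and
          \<open>c\<close> and could be added to the block.\<close>
        have "conn (D \<union> (B - {b}))"
          using D(1) block_conn_del[OF blk bb(1)] d(3) _ d(4) by (rule conn_Un) (use bb \<open>b \<noteq> b'\<close> in auto)
        then have con: "conn ((D \<union> (B - {b})) \<inter> nbs b)" using D(2) bb by (intro conn_nbs) auto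
        obtain x y where "x \<in> B" "y \<in> B" "x = b" "y \<noteq> b" "adj x y"
          by (rule conn_edge[of B b "\<lambda>z. z = b" b', OF block_conn[OF blk] bb(1) refl bb(2)])
            (use \<open>b \<noteq> b'\<close> in auto)
        then have y: "y \<in> (D \<union> (B - {b})) \<inter> nbs b" "y \<notin> D" using D(2) by auto
        have dd: "d \<in> (D \<union> (B - {b})) \<inter> nbs b" using d(1) adj_sym[OF d(2)] by simp
        obtain e c where e: "e \<in> (D \<union> (B - {b})) \<inter> nbs b" and c: "c \<in> (D \<union> (B - {b})) \<inter> nbs b"
          and ec: "e \<in> D" "c \<notin> D" "adj e c"
          by (rule conn_edge[of _ d "\<lambda>z. z \<in> D" y, OF con dd d(1) y])
        have "e \<notin> B" using ec(1) D(2) by blast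
        have "block (insert e B)"
        proof (rule block_insert[OF blk \<open>e \<notin> B\<close> bb(1)])
          show "c \<in> B" "b \<noteq> c" "adj e c" using c ec by auto
          show "adj e b" using e adj_sym[of b e] by simp
        qed
        then have "card (insert e B) \<le> card B" using B ec(1) D(2) by (intro max) blast
        then show False using \<open>e \<notin> B\<close> finB by simp
      qed
      \<comment> \<open>The union of those components of \<open>X - B\<close> that touch
        \<open>b\<close>; by \<open>single_attachment\<close> a component touches no other vertex of
        \<open>B\<close>.\<close>
      define H where "H b = {x \<in> X - B. \<exists>y\<in>comp (X - B) x. adj y b}" for b
      have Hsub: "H b \<subseteq> X - B" for b by (auto simp: H_def)
      have Hdisj: "H b \<inter> H c = {}" if "b \<in> B" "c \<in> B" "b \<noteq> c" for b c
      proof (rule ccontr)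
        assume "H b \<inter> H c \<noteq> {}"
        then obtain x where x: "x \<in> H b" "x \<in> H c" by blast
        then obtain y z where "y \<in> comp (X - B) x" "adj y b" "z \<in> comp (X - B) x" "adj z c"
          by (auto simp: H_def)
        then have "b = c"
          using single_attachment[OF conn_comp comp_subset, of x y b z c] x Hsub that by blast
        then show False using that by simp
      qed
      have Hcover: "X - B \<subseteq> (\<Union>b\<in>B. H b)"
      proof
        fix x assume x: "x \<in> X - B"
        let ?C = "comp (X - B) x"
        have CX: "?C \<subseteq> X - B" using comp_subset[OF x] .
        obtain w where w: "w \<in> X" "w \<notin> ?C" using BX CX by blast
        have xX: "x \<in> X" using x by blast
        obtain y z where "y \<in> X" and z: "z \<in> X" and y: "y \<in> ?C" "z \<notin> ?C" "adj y z"
          by (rule conn_edge[of X x "\<lambda>v. v \<in> ?C" w, OF \<open>conn X\<close> xX comp_refl w])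
        then have "z \<in> B" using comp_closed[OF y(1) y(3)] by blast
        then show "x \<in> (\<Union>b\<in>B. H b)" using x y by (auto simp: H_def)
      qed
      have Hnbs: "nbs x \<inter> (V - H b) \<subseteq> {b}" if b: "b \<in> B" and x: "x \<in> H b" for b x
      proof
        fix z assume z: "z \<in> nbs x \<inter> (V - H b)"
        obtain y where y: "y \<in> comp (X - B) x" "adj y b" using x by (auto simp: H_def)
        have xXB: "x \<in> X - B" using x Hsub by blast
        have "z \<in> B"
        proof (rule ccontr)
          assume "z \<notin> B"
          then have zXB: "z \<in> X - B" using nbsS[of x] z xXB B(2) by blast
          have "adj z x" using z by (simp add: adj_sym)
          have "comp (X - B) x \<subseteq> comp (X - B) z"
          proof -
            have xz: "x \<in> comp (X - B) z" using comp_closed[OF comp_refl \<open>adj z x\<close> xXB] .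
            then show ?thesis unfolding comp_def by (auto intro: rtranclp_trans)
          qed
          then have "z \<in> H b" using y zXB by (auto simp: H_def)
          then show False using z by blast
        qed
        \<comment> \<open>The component of \<open>x\<close> touches \<open>b\<close> by the choice
          of \<open>H b\<close> and touches \<open>z\<close> through \<open>x\<close>
          itself.\<close>
        then have "b = z"
          using single_attachment[OF conn_comp comp_subset[OF xXB] y comp_refl _ b, of z] z by simp
        then show "z \<in> {b}" by simp
      qed
      have decH: "dec 1026 V (H b)" if b: "b \<in> B" for b
      proof (rule less.hyps[of _ "{b}"])
        have "H b \<subset> X" using Hsub[of b] BX by blast
        then show "card (H b) < card X" using finX by (intro psubset_card_mono)
        show "H b \<subseteq> V" using Hsub X(1) by blast
        show "{b} \<subseteq> V - H b" using Hsub b B(1) X(1) S'(1) by blast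
        show "nbs x \<inter> (V - H b) \<subseteq> {b}" if "x \<in> H b" for x using Hnbs b that .
      qed simp
      have "dec (2 * 512 + 2) V ((B - ?S) \<union> (\<Union>b\<in>B. H b))"
        using X(1) S' nbsS B by (rule dec_attach[where k = 512 and B = B])
          (use decH Hsub Hnbs Hdisj Hcover block_dec[OF blk] in auto)
      moreover have "(\<Union>b\<in>B. H b) = X - B" by (intro equalityI UN_least Hsub Hcover)
      moreover have "?S \<inter> X = {}" using S'(1) by auto
      with B(1) have "(B - ?S) \<union> (X - B) = X" by auto
      ultimately show ?thesis by simp
    qed
  qed
qed

end

section \<open>From splittings to clique-width\<close>

lemma cw_labelled_join_pairs:
  assumes G: "cw_labelled k G l" and P: "finite P"
    "\<And>i j. (i, j) \<in> P \<Longrightarrow> i \<in> {1..k} \<and> j \<in> {1..k} \<and> i \<noteq> j"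
  shows "cw_labelled k \<lparr> pverts = pverts G,
    parcs = parcs G \<union> {(u, v). u \<in> pverts G \<and> v \<in> pverts G \<and> ((l u, l v) \<in> P \<or> (l v, l u) \<in> P)} \<rparr> l"
  using P
proof (induction P rule: finite_induct)
  case empty
  then show ?case using G by (cases G) simp
next
  case (insert p P)
  obtain i j where p: "p = (i, j)" by force
  have ij: "i \<in> {1..k}" "j \<in> {1..k}" "i \<noteq> j" using insert.prems[of i j] p by auto
  have eq: "parcs G \<union> {(u, v). u \<in> pverts G \<and> v \<in> pverts G \<and> ((l u, l v) \<in> P \<or> (l v, l u) \<in> P)} \<union>
      {(u, v). u \<in> pverts G \<and> v \<in> pverts G \<and> (l u = i \<and> l v = j \<or> l u = j \<and> l v = i)} =
      parcs G \<union> {(u, v). u \<in> pverts G \<and> v \<in> pverts G \<and>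
        ((l u, l v) \<in> insert p P \<or> (l v, l u) \<in> insert p P)}"
    unfolding p by auto
  have "cw_labelled k \<lparr> pverts = pverts G, parcs = parcs G \<union>
      {(u, v). u \<in> pverts G \<and> v \<in> pverts G \<and> ((l u, l v) \<in> P \<or> (l v, l u) \<in> P)} \<rparr> l"
    using insert by blast
  from cw_labelled.join[OF this ij] show ?case by (simp add: eq)
qed

text \<open>Since no new label lies in \<open>A\<close>, no vertex is renamed twice and the
  successive renamings act as one simultaneous map.\<close>

lemma cw_labelled_relabel_set:
  assumes G: "cw_labelled k G l" and A: "A \<subseteq> {1..k}" "f ` A \<subseteq> {1..k}" "f ` A \<inter> A = {}"
  shows "cw_labelled k G (\<lambda>v. if l v \<in> A then f (l v) else l v)"
proof -
  have "finite A" using A(1) by (rule finite_subset) simp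
  then show ?thesis using A
  proof (induction A rule: finite_induct)
    case empty
    then show ?case using G by simp
  next
    case (insert i A)
    have "cw_labelled k G (\<lambda>v. if l v \<in> A then f (l v) else l v)" using insert by auto
    from cw_labelled.relabel[OF this, of i "f i"] insert.prems
    have "cw_labelled k G (\<lambda>v. if (if l v \<in> A then f (l v) else l v) = i then f i
        else (if l v \<in> A then f (l v) else l v))" by auto
    moreover have "(\<lambda>v. if (if l v \<in> A then f (l v) else l v) = i then f i
        else (if l v \<in> A then f (l v) else l v)) = (\<lambda>v. if l v \<in> insert i A then f (l v) else l v)"
      using insert.hyps insert.prems(3) by (auto simp: fun_eq_iff)
    ultimately show ?case by simp
  qed
qed

context adjacency
begin

definition induced :: "'a set \<Rightarrow> 'a pair_pre_digraph" where
  "induced X = \<lparr> pverts = X, parcs = {(u, v). u \<in> X \<and> v \<in> X \<and> adj u v} \<rparr>"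

text \<open>The labels record types, so vertices with equal labels may be treated alike from then
  on. Three ranges of \<open>k\<close> labels suffice: one for \<open>X\<close>, one for
  \<open>Y\<close>, and one as intermediate space for the types of the union.\<close>

lemma dec_cw_labelled:
  assumes "dec k U X" "X \<subseteq> U" "X \<noteq> {}"
  shows "\<exists>l. cw_labelled (3 * k) (induced X) l \<and> l ` X \<subseteq> {1..k} \<and>
    (\<forall>x\<in>X. \<forall>y\<in>X. l x = l y \<longrightarrow> nbs x \<inter> (U - X) = nbs y \<inter> (U - X))"
  using assms
proof (induction rule: dec.induct)
  case dec_empty
  then show ?case by simp
next
  case (dec_single v)
  have "induced {v} = \<lparr> pverts = {v}, parcs = {} \<rparr>" using adj_irrefl by (auto simp: induced_def)
  with dec_single cw_labelled.create[of 1 "3 * k" v] show ?case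
    by (intro exI[of _ "\<lambda>_. 1"]) auto
next
  case (dec_Un X Y)
  show ?case
  proof (cases "X = {}")
    case True
    then show ?thesis using dec_Un.IH(2) dec_Un.prems by simp
  next
    case X_nonempty: False
    show ?thesis
    proof (cases "Y = {}")
      case True
      then show ?thesis using dec_Un.IH(1) dec_Un.prems by simp
    next
      case Y_nonempty: False
      let ?Z = "X \<union> Y" and ?K = "3 * k"
      have XU: "X \<subseteq> U" and YU: "Y \<subseteq> U" using dec_Un.prems(1) by auto
      from dec_Un.IH(1)[OF XU X_nonempty]
      obtain l where l: "cw_labelled ?K (induced X) l" "l ` X \<subseteq> {1..k}"
        and l_types: "\<forall>x\<in>X. \<forall>y\<in>X. l x = l y \<longrightarrow> nbs x \<inter> (U - X) = nbs y \<inter> (U - X)"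
        by (elim exE conjE)
      from dec_Un.IH(2)[OF YU Y_nonempty]
      obtain m where m: "cw_labelled ?K (induced Y) m" "m ` Y \<subseteq> {1..k}"
        and m_types: "\<forall>x\<in>Y. \<forall>y\<in>Y. m x = m y \<longrightarrow> nbs x \<inter> (U - Y) = nbs y \<inter> (U - Y)"
        by (elim exE conjE)
      define m' where "m' v = (if m v \<in> {1..k} then m v + k else m v)" for v
      define q where "q v = (if v \<in> X then l v else m' v)" for v
      have qX: "q v = l v" "l v \<in> {1..k}" if "v \<in> X" for v
        using that l(2) by (auto simp: q_def)
      have qY: "q v = m v + k" "m v \<in> {1..k}" if "v \<in> Y" for v
      proof -
        show mv: "m v \<in> {1..k}" using that m(2) by auto
        have "v \<notin> X" using that dec_Un.hyps(3) by auto
        with mv show "q v = m v + k" by (simp add: q_def m'_def)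
      qed
      have "cw_labelled ?K (induced Y) m'" unfolding m'_def
        by (rule cw_labelled_relabel_set[OF m(1), of "{1..k}" "\<lambda>i. i + k"]) auto
      from cw_labelled.disjoint_union[OF l(1) this] dec_Un.hyps(3)
      have q: "cw_labelled ?K \<lparr> pverts = ?Z, parcs = parcs (induced X) \<union> parcs (induced Y) \<rparr> q"
        unfolding q_def by (simp add: induced_def)
      define P where "P = (\<lambda>(x, y). (q x, q y)) ` {(x, y). x \<in> X \<and> y \<in> Y \<and> adj x y}"
      have fin: "finite X" "finite Y" using dec_Un.hyps(1,2) by (simp_all add: dec_finite)
      have "{(x, y). x \<in> X \<and> y \<in> Y \<and> adj x y} \<subseteq> X \<times> Y" by auto
      then have "finite {(x, y). x \<in> X \<and> y \<in> Y \<and> adj x y}"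
        by (rule finite_subset) (simp add: fin)
      then have finP: "finite P" unfolding P_def by (rule finite_imageI)
      have PD: "i \<in> {1..?K} \<and> j \<in> {1..?K} \<and> i \<noteq> j" if ij: "(i, j) \<in> P" for i j
      proof -
        obtain x y where "x \<in> X" "y \<in> Y" "i = q x" "j = q y" using ij by (auto simp: P_def)
        then show ?thesis using qX[of x] qY[of y] by auto
      qed
      \<comment> \<open>Labels determine neighbourhoods outside the own part, so a join never
        creates a wrong edge between \<open>X\<close> and \<open>Y\<close>; the ranges
        \<open>1..k\<close> and \<open>k + 1..2 * k\<close> tell the parts apart.\<close>
      have cross: "(q x, q y) \<in> P \<longleftrightarrow> x \<in> X \<and> y \<in> Y \<and> adj x y" if xy: "x \<in> ?Z" "y \<in> ?Z" for x y
      proof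
        assume "(q x, q y) \<in> P"
        then obtain x' y' where x': "x' \<in> X" "q x = q x'" and y': "y' \<in> Y" "q y = q y'"
          and adj: "adj x' y'" by (auto simp: P_def)
        have x: "x \<in> X" using xy(1) x' qX[of x'] qY[of x] by auto
        have y: "y \<in> Y" using xy(2) y' qX[of y] qY[of y'] by auto
        have "nbs x \<inter> (U - X) = nbs x' \<inter> (U - X)" using x x' qX[of x] qX[of x'] by (intro l_types[rule_format]) auto
        moreover have "y' \<in> U - X" using y' dec_Un.hyps(3) dec_Un.prems by auto
        ultimately have "adj x y'" using adj by auto
        then have "adj y' x" by (rule adj_sym)
        have "nbs y \<inter> (U - Y) = nbs y' \<inter> (U - Y)" using y y' qY[of y] qY[of y'] by (intro m_types[rule_format]) auto
        moreover have "x \<in> U - Y" using x dec_Un.hyps(3) dec_Un.prems by auto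
        ultimately have "adj y x" using \<open>adj y' x\<close> by auto
        then show "x \<in> X \<and> y \<in> Y \<and> adj x y" using x y adj_sym by blast
      qed (auto simp: P_def)
      have arcs: "parcs (induced X) \<union> parcs (induced Y) \<union>
          {(u, v). u \<in> ?Z \<and> v \<in> ?Z \<and> ((q u, q v) \<in> P \<or> (q v, q u) \<in> P)} = parcs (induced ?Z)"
      proof -
        have "((q u, q v) \<in> P \<or> (q v, q u) \<in> P) \<longleftrightarrow>
            (u \<in> X \<and> v \<in> Y \<or> v \<in> X \<and> u \<in> Y) \<and> adj u v" if "u \<in> ?Z" "v \<in> ?Z" for u v
          using cross[OF that] cross[OF that(2,1)] adj_sym[of u v] adj_sym[of v u] by blast
        then show ?thesis by (auto simp: induced_def)
      qed
      have joined: "cw_labelled ?K (induced ?Z) q"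
        using cw_labelled_join_pairs[OF q finP PD] arcs by (simp add: induced_def)
      have "finite (types U ?Z)" using fin by (simp add: finite_types)
      then obtain g :: "'a set \<Rightarrow> nat" where g: "inj_on g (types U ?Z)" "g ` types U ?Z \<subseteq> {1..k}"
        using inj_on_iff_card_le[of "types U ?Z" "{1..k}"] dec_Un.hyps(4) by auto
      define T where "T v = nbs v \<inter> (U - ?Z)" for v
      have Tin: "T v \<in> types U ?Z" if "v \<in> ?Z" for v using that by (auto simp: types_def T_def)
      have Teq: "T u = T v" if uv: "u \<in> ?Z" "v \<in> ?Z" "q u = q v" for u v
      proof -
        consider "u \<in> X" "v \<in> X" | "u \<in> Y" "v \<in> Y"
          using uv qX[of u] qX[of v] qY[of u] qY[of v] by fastforce
        then show ?thesis
        proof cases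
          case 1
          then have "nbs u \<inter> (U - X) = nbs v \<inter> (U - X)"
            using uv(3) qX(1)[of u] qX(1)[of v] by (intro l_types[rule_format]) auto
          then show ?thesis by (auto simp: T_def)
        next
          case 2
          then have "nbs u \<inter> (U - Y) = nbs v \<inter> (U - Y)"
            using uv(3) qY(1)[of u] qY(1)[of v] by (intro m_types[rule_format]) auto
          then show ?thesis by (auto simp: T_def)
        qed
      qed
      \<comment> \<open>Any vertex with label \<open>i\<close> may represent it, since by
        \<open>Teq\<close> the type in the union depends on the label only.\<close>
      define rep where "rep i = (SOME v. v \<in> ?Z \<and> q v = i)" for i
      have rep: "rep (q v) \<in> ?Z" "q (rep (q v)) = q v" if "v \<in> ?Z" for v
        using someI[of "\<lambda>w. w \<in> ?Z \<and> q w = q v" v] that unfolding rep_def by auto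
      define f where "f i = 2 * k + g (T (rep i))" for i
      have fq: "f (q v) = 2 * k + g (T v)" if "v \<in> ?Z" for v
        using Teq[OF rep(1)[OF that] that rep(2)[OF that]] by (simp add: f_def)
      have qZ: "q ` ?Z \<subseteq> {1..2 * k}" using qX qY by fastforce
      have gT: "g (T v) \<in> {1..k}" if "v \<in> ?Z" for v using g(2) Tin[OF that] by blast
      define q1 where "q1 v = (if q v \<in> q ` ?Z then f (q v) else q v)" for v
      have q1: "cw_labelled ?K (induced ?Z) q1" unfolding q1_def
      proof (rule cw_labelled_relabel_set[OF joined])
        show "q ` ?Z \<subseteq> {1..?K}" using qZ by auto
        have "f i \<in> {2 * k + 1..?K}" if i: "i \<in> q ` ?Z" for i
        proof -
          obtain v where v: "v \<in> ?Z" "i = q v" using i by blast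
          then show ?thesis using fq[OF v(1)] gT[OF v(1)] by auto
        qed
        then have im: "f ` q ` ?Z \<subseteq> {2 * k + 1..?K}" by blast
        also have "\<dots> \<subseteq> {1..?K}" by auto
        finally show "f ` q ` ?Z \<subseteq> {1..?K}" .
        have "{2 * k + 1..?K} \<inter> {1..2 * k} = {}" by auto
        then show "f ` q ` ?Z \<inter> q ` ?Z = {}" using im qZ by blast
      qed
      have q1v: "q1 v = 2 * k + g (T v)" if "v \<in> ?Z" for v using fq that by (auto simp: q1_def)
      \<comment> \<open>The type labels in \<open>2 * k + 1..3 * k\<close> are moved down to
        \<open>1..k\<close>, which is free by now, to restore the invariant.\<close>
      define q2 where "q2 v = (if q1 v \<in> {2 * k + 1..?K} then q1 v - 2 * k else q1 v)" for v
      have q2: "cw_labelled ?K (induced ?Z) q2" unfolding q2_def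
        by (rule cw_labelled_relabel_set[OF q1, of _ "\<lambda>i. i - 2 * k"]) auto
      have q2v: "q2 v = g (T v)" if "v \<in> ?Z" for v
        using q1v[OF that] gT[OF that] by (auto simp: q2_def)
      have "T x = T y" if "x \<in> ?Z" "y \<in> ?Z" "q2 x = q2 y" for x y
        using g(1) Tin that q2v[of x] q2v[of y] by (auto dest: inj_onD)
      then show ?thesis using q2 q2v gT by (intro exI[of _ q2]) (auto simp: T_def)
    qed
  qed
qed

end

section \<open>The forbidden induced subgraphs in terms of adjacency\<close>

lemma free_ofD:
  assumes "free_of H G" "pair_graph G" "pair_graph H" "inj_on f (pverts H)" "f ` pverts H \<subseteq> pverts G"
    "\<And>u v. u \<in> pverts H \<Longrightarrow> v \<in> pverts H \<Longrightarrow> (u, v) \<in> parcs H \<longleftrightarrow> (f u, f v) \<in> parcs G"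
  shows False
  using assms free_of_iff[of G H] by blast

lemma complement_arc:
  "(u, v) \<in> parcs (complement G) \<longleftrightarrow> u \<in> pverts G \<and> v \<in> pverts G \<and> u \<noteq> v \<and> (u, v) \<notin> parcs G"
  by (simp add: complement_def)

lemma sum_simps:
  "Inl a \<in> pverts (G \<oplus>\<^sub>G H) \<longleftrightarrow> a \<in> pverts G"
  "Inr b \<in> pverts (G \<oplus>\<^sub>G H) \<longleftrightarrow> b \<in> pverts H"
  "(Inl a, Inl a') \<in> parcs (G \<oplus>\<^sub>G H) \<longleftrightarrow> (a, a') \<in> parcs G"
  "(Inr b, Inr b') \<in> parcs (G \<oplus>\<^sub>G H) \<longleftrightarrow> (b, b') \<in> parcs H"
  "(Inl a, Inr b) \<notin> parcs (G \<oplus>\<^sub>G H)" "(Inr b, Inl a) \<notin> parcs (G \<oplus>\<^sub>G H)"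
  by (auto simp: graph_sum_def)

theorem theorem3:
  shows "bounded_clique_width
    {G :: 'a pair_pre_digraph.
       pair_graph G \<and> free_of (complement (claw \<oplus>\<^sub>G (P1 \<oplus>\<^sub>G P1))) G \<and> chordal G}"
  unfolding bounded_clique_width_def
proof (intro exI ballI)
  fix G :: "'a pair_pre_digraph"
  assume "G \<in> {G. pair_graph G \<and> free_of (complement (claw \<oplus>\<^sub>G (P1 \<oplus>\<^sub>G P1))) G \<and> chordal G}"
  then have G: "pair_graph G" and free: "free_of (complement (claw \<oplus>\<^sub>G (P1 \<oplus>\<^sub>G P1))) G"
    and chordal: "chordal G" by auto
  let ?V = "pverts G"
  define adj where "adj u v \<longleftrightarrow> (u, v) \<in> parcs G" for u v
  have fin: "finite ?V" and arcs: "parcs G \<subseteq> ?V \<times> ?V" and "sym (parcs G)" "\<And>v. (v, v) \<notin> parcs G"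
    using G unfolding pair_graph_iff by auto
  then interpret adjacency adj
    by unfold_locales (auto simp: adj_def dest: symD)
  have no_hole: False if r: "r \<ge> 4" and f: "inj_on f {..<r}"
      "\<And>i j. i < r \<Longrightarrow> j < r \<Longrightarrow> adj (f i) (f j) \<longleftrightarrow> j = Suc i mod r \<or> i = Suc j mod r" for r f
  proof (rule free_ofD)
    show "free_of (cycle_graph r) G" using chordal r by (auto simp: chordal_def)
    show "pair_graph (cycle_graph r)" using r by (intro pair_graph_cycle_graph) simp
    show "inj_on f (pverts (cycle_graph r))" using f(1) by (simp add: cycle_graph_def lessThan_atLeast0)
    \<comment> \<open>The hole is not assumed to lie in the graph, but each of its vertices has a
      neighbour and so is the end of an arc.\<close>
    show "f ` pverts (cycle_graph r) \<subseteq> ?V"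
    proof -
      have "f i \<in> ?V" if "i < r" for i
      proof -
        have "adj (f i) (f (Suc i mod r))" using f(2)[of i "Suc i mod r"] that by simp
        then show ?thesis using arcs by (auto simp: adj_def)
      qed
      then show ?thesis by (auto simp: cycle_graph_def)
    qed
    show "(u, v) \<in> parcs (cycle_graph r) \<longleftrightarrow> (f u, f v) \<in> parcs G"
      if "u \<in> pverts (cycle_graph r)" "v \<in> pverts (cycle_graph r)" for u v
      using f(2)[of u v] that by (auto simp: cycle_graph_def adj_def)
  qed fact
  interpret chordal_adjacency adj
  proof
    fix Y u assume "conn Y" "u \<notin> Y"
    then show "conn (Y \<inter> nbs u)" by (rule conn_nbs_if_no_holes[rotated]) (rule no_hole)
  qed
  let ?H = "complement (claw \<oplus>\<^sub>G (P1 \<oplus>\<^sub>G P1))"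
  \<comment> \<open>In the complement the centre of the claw sees only the two isolated vertices,
    while these and the three leaves form a \<open>K\<^sub>5\<close>. Hence \<open>w\<close> is the
    centre, two seen vertices \<open>a\<close>, \<open>b\<close> of \<open>K\<close> are the
    isolated ones, and three missed vertices \<open>x\<close>, \<open>y\<close>, \<open>z\<close>
    are the leaves.\<close>
  interpret thin_chordal adj
  proof (unfold_locales, rule ccontr)
    fix K w assume K: "clique K" "finite K" "w \<notin> K" "2 \<le> card (K \<inter> nbs w)" "\<not> card (K - nbs w) \<le> 2"
    obtain A where A: "A \<subseteq> K \<inter> nbs w" "card A = 2"
      by (rule obtain_subset_with_card_n[OF K(4)])
    have "3 \<le> card (K - nbs w)" using K(5) by linarith
    then obtain B where B: "B \<subseteq> K - nbs w" "card B = 3"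
      by (rule obtain_subset_with_card_n)
    obtain a b where ab: "A = {a, b}" "a \<noteq> b" using A(2) by (auto simp: card_2_iff)
    obtain x y z where xyz: "B = {x, y, z}" "x \<noteq> y" "y \<noteq> z" "x \<noteq> z"
      using B(2) by (auto simp: card_3_iff)
    have mem: "a \<in> K" "b \<in> K" "x \<in> K" "y \<in> K" "z \<in> K" using A(1) B(1) ab xyz by auto
    have wadj: "adj w a" "adj w b" "\<not> adj w x" "\<not> adj w y" "\<not> adj w z" using A(1) B(1) ab xyz by auto
    have wadj': "adj a w" "adj b w" "\<not> adj x w" "\<not> adj y w" "\<not> adj z w"
      using wadj adj_sym by blast+
    have ne: "a \<noteq> x" "a \<noteq> y" "a \<noteq> z" "b \<noteq> x" "b \<noteq> y" "b \<noteq> z" using wadj by auto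
    have wne: "w \<noteq> a" "w \<noteq> b" "w \<noteq> x" "w \<noteq> y" "w \<noteq> z" using mem K(3) by auto
    have Kadj: "adj u v" if "u \<in> {a, b, x, y, z}" "v \<in> {a, b, x, y, z}" "u \<noteq> v" for u v
      using that mem cliqueD[OF K(1)] by auto
    define f :: "nat + nat + nat \<Rightarrow> 'a" where
      "f v = (case v of Inl i \<Rightarrow> [w, x, y, z] ! i | Inr (Inl _) \<Rightarrow> a | Inr (Inr _) \<Rightarrow> b)" for v
    have V: "pverts ?H = {Inl 0, Inl 1, Inl 2, Inl 3, Inr (Inl 0), Inr (Inr 0)}"
      by (auto simp: complement_def graph_sum_def claw_def P1_def)
    have f: "f (Inl 0) = w" "f (Inl 1) = x" "f (Inl 2) = y" "f (Inl 3) = z"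
      "f (Inr (Inl 0)) = a" "f (Inr (Inr 0)) = b" by (simp_all add: f_def)
    show False
    proof (rule free_ofD[OF free G, of f])
      show "pair_graph ?H"
        by (intro pair_graph_complement pair_graph_sum pair_graph_claw pair_graph_P1)
      show "inj_on f (pverts ?H)" unfolding V using f ab xyz ne wne by (auto simp: inj_on_def)
      have "w \<in> ?V" "a \<in> ?V" "b \<in> ?V" using wadj arcs by (auto simp: adj_def)
      moreover have "x \<in> ?V" "y \<in> ?V" "z \<in> ?V"
        using Kadj[of x a] Kadj[of y a] Kadj[of z a] ne arcs by (auto simp: adj_def)
      ultimately show "f ` pverts ?H \<subseteq> ?V" unfolding V using f by simp
      have Ks: "adj x y" "adj y x" "adj x z" "adj z x" "adj y z" "adj z y" "adj a b" "adj b a"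
        "adj a x" "adj a y" "adj a z" "adj b x" "adj b y" "adj b z"
        "adj x a" "adj y a" "adj z a" "adj x b" "adj y b" "adj z b"
        by (rule Kadj; use ab(2) xyz(2-4) ne in simp)+
      have "\<forall>u\<in>pverts ?H. \<forall>v\<in>pverts ?H. (u, v) \<in> parcs ?H \<longleftrightarrow> adj (f u) (f v)"
        unfolding V by (simp add: complement_arc sum_simps P1_def claw_def f Ks wadj wadj' adj_irrefl
          del: One_nat_def)
      then have "(u, v) \<in> parcs ?H \<longleftrightarrow> adj (f u) (f v)" if "u \<in> pverts ?H" "v \<in> pverts ?H" for u v
        using that by blast
      then show "(u, v) \<in> parcs ?H \<longleftrightarrow> (f u, f v) \<in> parcs G"
        if "u \<in> pverts ?H" "v \<in> pverts ?H" for u v using that by (simp add: adj_def)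
    qed
  qed
  show "clique_width G \<le> 3 * 1026"
  proof (cases "?V = {}")
    case True
    then show ?thesis by (simp add: clique_width_def)
  next
    case False
    \<comment> \<open>The whole graph hangs on nothing, so the attachment set is empty.\<close>
    have "dec 1026 ?V ?V" using dec_one_attachment[OF fin, of ?V "{}"] by simp
    then obtain l where "cw_labelled (3 * 1026) (induced ?V) l"
      using dec_cw_labelled[of 1026 ?V ?V] False by blast
    moreover have "parcs (induced ?V) = parcs G" using arcs by (auto simp: induced_def adj_def)
    then have "induced ?V = G" by (cases G) (simp add: induced_def)
    ultimately have "\<exists>l. cw_labelled (3 * 1026) G l" by auto
    then show ?thesis using False by (auto simp: clique_width_def intro: Least_le)
  qed
qed

end
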